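(* No Schnorr random $A\in\{0,1\}^\omega$ is low for speed. Consequently the set $\mathsf{LFS}$ of low for speed oracles has Lebesgue (uniform) measure $0$ in $\{0,1\}^\omega$.
   Context: Oracles are languages $X\subseteq\{0,1\}^*$, identified with subsets of $\mathbb{N}$ (the $(n+1)$-th string in length-lexicographic order corresponds to $n$) and with infinite binary sequences in $\{0,1\}^\omega$. Oracle computations are measured in the usual complexity-theoretic model: the machine has a query tape, and once a string $x$ is written on it, the answer to "is $x\in X$?" is obtained in time $O(1)$. An oracle $X$ is \emph{low for speed} if for every computable (decidable) language $L$: whenever some oracle Turing machine $M$ with oracle $X$ decides $L$ within time bound $f$ (i.e. $time(M^X,x)\le f(x)$ for all inputs $x$), there exist a Turing machine $M'$ without oracle and a polynomial $p$ such that $M'$ decides $L$ within time bound $p\circ f$. $\mathsf{LFS}$ denotes the set of low for speed oracles. *)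

theory Defs
  imports "HOL-Probability.Probability" "HOL-Computational_Algebra.Polynomial"
begin

text \<open>Binary strings are bool lists (False = 0, True = 1). An oracle is an infinite
binary sequence A :: nat => bool; the string x is in the oracle iff A (str_to_nat x),
where str_to_nat x is the position of x in length-lexicographic order (the empty string
has index 0, "0" index 1, "1" index 2, "00" index 3, ...).\<close>

definition bin_val :: "bool list \<Rightarrow> nat" where
  "bin_val xs = foldl (\<lambda>acc b. 2 * acc + (if b then 1 else 0)) 0 xs"

definition str_to_nat :: "bool list \<Rightarrow> nat" where
  "str_to_nat xs = 2 ^ length xs - 1 + bin_val xs"

text \<open>A multi-tape oracle Turing machine. Tape 0 is the input tape, tape 1 is the query
tape. Tape symbols are naturals below nsyms; 0 is blank, 1 encodes bit 0, 2 encodes bit 1.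
Moves are -1 (left), 0 (stay), 1 (right); moving left at cell 0 stays at cell 0.
In the query state the machine, in a single step, moves to q_yes or q_no according
to whether the string written on the query tape (the bit cells before the first non-bit
cell) belongs to the oracle.\<close>

record tm =
  ntapes :: nat
  nstates :: nat
  nsyms :: nat
  delta :: "nat \<Rightarrow> nat list \<Rightarrow> nat \<times> (nat \<times> int) list"
  q_start :: nat
  q_accept :: nat
  q_reject :: nat
  q_query :: nat
  q_yes :: nat
  q_no :: nat

definition wf_tm :: "tm \<Rightarrow> bool" where
  "wf_tm M \<longleftrightarrow>
     ntapes M \<ge> 2 \<and> nsyms M \<ge> 3 \<and>
     distinct [q_accept M, q_reject M, q_query M] \<and>
     (\<forall>q \<in> {q_start M, q_accept M, q_reject M, q_query M, q_yes M, q_no M}. q < nstates M) \<and>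
     (\<forall>q < nstates M. \<forall>ss. length ss = ntapes M \<and> (\<forall>s \<in> set ss. s < nsyms M) \<longrightarrow>
        (case delta M q ss of (q', acts) \<Rightarrow>
           q' < nstates M \<and> length acts = ntapes M \<and>
           (\<forall>(s, m) \<in> set acts. s < nsyms M \<and> m \<in> {-1, 0, 1})))"

type_synonym tape = "(nat \<Rightarrow> nat) \<times> nat"
type_synonym config = "nat \<times> tape list"

definition bit_sym :: "bool \<Rightarrow> nat" where
  "bit_sym b = (if b then 2 else 1)"

definition init_config :: "tm \<Rightarrow> bool list \<Rightarrow> config" where
  "init_config M x =
     (q_start M,
      ((\<lambda>i. if i < length x then bit_sym (x ! i) else 0), 0)
        # replicate (ntapes M - 1) ((\<lambda>_. 0), 0))"

definition read_syms :: "tape list \<Rightarrow> nat list" where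
  "read_syms ts = map (\<lambda>(c, h). c h) ts"

definition apply_act :: "tape \<Rightarrow> nat \<times> int \<Rightarrow> tape" where
  "apply_act t a = (case t of (c, h) \<Rightarrow> case a of (s, m) \<Rightarrow> (c(h := s), nat (int h + m)))"

definition query_word :: "tape list \<Rightarrow> bool list" where
  "query_word ts =
     (let c = fst (ts ! 1) in map (\<lambda>i. c i = 2) [0..<(LEAST i. c i \<notin> {1, 2})])"

definition step :: "tm \<Rightarrow> (nat \<Rightarrow> bool) \<Rightarrow> config \<Rightarrow> config" where
  "step M A cf = (case cf of (q, ts) \<Rightarrow>
     if q = q_accept M \<or> q = q_reject M then (q, ts)
     else if q = q_query M then
       ((if A (str_to_nat (query_word ts)) then q_yes M else q_no M), ts)
     else (case delta M q (read_syms ts) of (q', acts) \<Rightarrow> (q', map2 apply_act ts acts)))"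

definition run :: "tm \<Rightarrow> (nat \<Rightarrow> bool) \<Rightarrow> bool list \<Rightarrow> nat \<Rightarrow> config" where
  "run M A x t = (step M A ^^ t) (init_config M x)"

definition decides_within :: "tm \<Rightarrow> (nat \<Rightarrow> bool) \<Rightarrow> bool list set \<Rightarrow> (bool list \<Rightarrow> nat) \<Rightarrow> bool" where
  "decides_within M A L f \<longleftrightarrow> wf_tm M \<and>
     (\<forall>x. \<exists>t \<le> f x. fst (run M A x t) \<in> {q_accept M, q_reject M} \<and>
                   (fst (run M A x t) = q_accept M \<longleftrightarrow> x \<in> L))"

definition decides :: "tm \<Rightarrow> (nat \<Rightarrow> bool) \<Rightarrow> bool list set \<Rightarrow> bool" where
  "decides M A L \<longleftrightarrow> wf_tm M \<and>
     (\<forall>x. \<exists>t. fst (run M A x t) \<in> {q_accept M, q_reject M} \<and>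
              (fst (run M A x t) = q_accept M \<longleftrightarrow> x \<in> L))"

abbreviation no_oracle :: "nat \<Rightarrow> bool" where
  "no_oracle \<equiv> (\<lambda>_. False)"

definition computable_lang :: "bool list set \<Rightarrow> bool" where
  "computable_lang L \<longleftrightarrow> (\<exists>M. decides M no_oracle L)"

definition low_for_speed :: "(nat \<Rightarrow> bool) \<Rightarrow> bool" where
  "low_for_speed X \<longleftrightarrow>
     (\<forall>L. computable_lang L \<longrightarrow>
        (\<forall>M f. decides_within M X L f \<longrightarrow>
           (\<exists>M' (p :: nat poly). decides_within M' no_oracle L (\<lambda>x. poly p (f x)))))"

definition LFS :: "(nat \<Rightarrow> bool) set" where
  "LFS = {X. low_for_speed X}"

definition coin_space :: "(nat \<Rightarrow> bool) measure" where
  "coin_space = PiM UNIV (\<lambda>_::nat. measure_pmf (bernoulli_pmf (1/2)))"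

definition extends :: "(nat \<Rightarrow> bool) \<Rightarrow> bool list \<Rightarrow> bool" where
  "extends A \<sigma> \<longleftrightarrow> (\<forall>i < length \<sigma>. A i = \<sigma> ! i)"

text \<open>Unary / self-delimiting codes used to present sets of tuples as languages.\<close>

definition enc_nat :: "nat \<Rightarrow> bool list" where
  "enc_nat n = replicate n True @ [False]"

definition enc_int :: "int \<Rightarrow> bool list" where
  "enc_int a = (a \<ge> 0) # enc_nat (nat \<bar>a\<bar>)"

definition ce_lang :: "bool list set \<Rightarrow> bool" where
  "ce_lang W \<longleftrightarrow> (\<exists>D. computable_lang D \<and> W = {w. \<exists>k. enc_nat k @ w \<in> D})"

definition unif_sigma01 :: "(nat \<Rightarrow> (nat \<Rightarrow> bool) set) \<Rightarrow> bool" where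
  "unif_sigma01 U \<longleftrightarrow> (\<exists>W. ce_lang W \<and>
      (\<forall>n. U n = {A. \<exists>\<sigma>. enc_nat n @ \<sigma> \<in> W \<and> extends A \<sigma>}))"

text \<open>Uniformly computable sequence of reals: a computable (total) function F with
|r n - F n k / 2^k| <= 2^-k; F is computable iff its graph is decidable.\<close>

definition unif_computable_reals :: "(nat \<Rightarrow> real) \<Rightarrow> bool" where
  "unif_computable_reals r \<longleftrightarrow> (\<exists>F :: nat \<Rightarrow> nat \<Rightarrow> int.
      computable_lang {enc_nat n @ enc_nat k @ enc_int (F n k) | n k. True} \<and>
      (\<forall>n k. \<bar>r n - real_of_int (F n k) / 2 ^ k\<bar> \<le> 1 / 2 ^ k))"

definition schnorr_test :: "(nat \<Rightarrow> (nat \<Rightarrow> bool) set) \<Rightarrow> bool" where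
  "schnorr_test U \<longleftrightarrow> unif_sigma01 U \<and>
     (\<forall>n. measure coin_space (U n) \<le> 1 / 2 ^ n) \<and>
     unif_computable_reals (\<lambda>n. measure coin_space (U n))"

definition schnorr_random :: "(nat \<Rightarrow> bool) \<Rightarrow> bool" where
  "schnorr_random A \<longleftrightarrow> (\<forall>U. schnorr_test U \<longrightarrow> A \<notin> (\<Inter>n. U n))"

end

theory Submission
  imports Defs
begin

text \<open>Call a string \<open>x\<close> fast for \<open>A\<close> if \<open>A\<close> contains \<open>x0\<^sup>j\<close> for all \<open>j \<le> |x| div 2\<close>. A computable language
\<open>L\<close> diagonalizes against all oracle-free machines: at length \<open>2m\<close> it contains at most one string, the
first one on which machine number \<open>pfst m\<close> halts within a superpolynomial bound, and it contains this
string iff the machine rejects it. For random \<open>A\<close> and almost all \<open>m\<close>, the candidate of length \<open>2m\<close> is not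
fast (this fails with probability at most \<open>2\<^sup>-\<^sup>m\<close>) but some string of length \<open>2m\<close> is fast, since the queries of
the \<open>4\<^sup>m\<close> strings are disjoint. So an oracle machine can reject fast strings in linear time. If \<open>A\<close> were
low for speed, some oracle-free machine would decide \<open>L\<close> with polynomial running time on fast strings, hence
would halt within the bound on some string of length \<open>2m\<close>, and \<open>L\<close> disagrees with it.

The two exceptional events at length \<open>2m\<close> depend on finitely many bits of \<open>A\<close>, computably in \<open>m\<close>, and have
probability at most \<open>2\<^sup>-\<^sup>m\<close>; their tails form Schnorr tests, which catch every low for speed oracle and
therefore also give the null set.\<close>

section \<open>Programs for Turing machines\<close>

text \<open>Diagonalizing at every string of a length would put fast strings into \<open>L\<close>
  and ruin the quick rejection; hence one candidate per length, chosen without reference to the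
  oracle. A string of length \<open>2 * m\<close> asks \<open>m + 1\<close> queries. This makes a
  fixed candidate fast with probability 2^-(m+1), while the 4^m strings still contain 2^(m-1) fast
  ones on average; half the length is a number of queries that serves both ends. The candidate
  cannot be a fixed string such as the first of its length: the oracle-free machine is known to be
  quick only on fast strings, and which strings are fast depends on \<open>A\<close>. So the
  candidate is located by the halting of the machine itself. Lowness for speed admits arbitrary time
  bounds, so only the rejection of fast strings has to be efficient. Everything else may run on
  unary counters. All searches in \<open>L\<close> and in the Schnorr tests are bounded, so
  primitive recursive functions suffice, and one compiler to Turing machines provides the diagonal
  language and the deciders of the tests alike.\<close>

datatype com =
    Act "nat list \<Rightarrow> nat \<Rightarrow> nat \<times> int"
  | Seq com com
  | While "nat list \<Rightarrow> bool" com
  | Ask nat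

definition syms :: "nat \<Rightarrow> (nat \<Rightarrow> tape) \<Rightarrow> nat list" where
  "syms n T = map (\<lambda>i. fst (T i) (snd (T i))) [0..<n]"

text \<open>Forces written symbols and head moves into the ranges demanded by \<^const>\<open>wf_tm\<close>, so that every
program yields a well-formed machine.\<close>

definition sanitize :: "nat list \<Rightarrow> nat \<Rightarrow> nat \<times> int \<Rightarrow> nat \<times> int" where
  "sanitize ss i a = (if fst a \<le> 2 \<or> fst a = ss ! i then fst a else 0, sgn (snd a))"

definition actions :: "nat \<Rightarrow> (nat list \<Rightarrow> nat \<Rightarrow> nat \<times> int) \<Rightarrow> nat list \<Rightarrow> (nat \<times> int) list" where
  "actions n f ss = map (\<lambda>i. sanitize ss i (f ss i)) [0..<n]"

definition perform :: "nat \<Rightarrow> (nat list \<Rightarrow> nat \<Rightarrow> nat \<times> int) \<Rightarrow> (nat \<Rightarrow> tape) \<Rightarrow> nat \<Rightarrow> tape" where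
  "perform n f T = (\<lambda>i. if i < n then apply_act (T i) (sanitize (syms n T) i (f (syms n T) i)) else T i)"

definition move :: "(nat \<Rightarrow> int) \<Rightarrow> nat list \<Rightarrow> nat \<Rightarrow> nat \<times> int" where
  "move d ss i = (ss ! i, d i)"

abbreviation "stay \<equiv> move (\<lambda>_. 0)"
abbreviation "right r \<equiv> move (\<lambda>i. if i = r then 1 else 0)"
abbreviation "left r \<equiv> move (\<lambda>i. if i = r then - 1 else 0)"

fun clen :: "com \<Rightarrow> nat" where
  "clen (Act f) = 1"
| "clen (Seq c d) = clen c + clen d"
| "clen (While b c) = clen c + 2"
| "clen (Ask r) = 3"

text \<open>Entry \<open>i\<close> of the list is the transition of state \<open>p + i\<close>,
  control leaves at \<open>p + clen c\<close>, and \<open>Q\<close> is the query state. An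
  \<open>Ask\<close> occupies three states: one that enters \<open>Q\<close>, one for each answer.
  Both answers continue at the same state; a negative one is recorded by a head move on tape
  \<open>r\<close>.\<close>

fun compile :: "nat \<Rightarrow> nat \<Rightarrow> nat \<Rightarrow> com \<Rightarrow> (nat list \<Rightarrow> nat \<times> (nat \<times> int) list) list" where
  "compile n Q p (Act f) = [\<lambda>ss. (Suc p, actions n f ss)]"
| "compile n Q p (Seq c d) = compile n Q p c @ compile n Q (p + clen c) d"
| "compile n Q p (While b c) =
     [\<lambda>ss. (if b ss then Suc p else p + clen c + 2, actions n stay ss)] @ compile n Q (Suc p) c
       @ [\<lambda>ss. (p, actions n stay ss)]"
| "compile n Q p (Ask r) = [\<lambda>ss. (Q, actions n stay ss), \<lambda>ss. (p + 3, actions n stay ss), \<lambda>ss. (p + 3, actions n (right r) ss)]"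

fun asks :: "nat \<Rightarrow> com \<Rightarrow> nat set" where
  "asks p (Act f) = {}"
| "asks p (Seq c d) = asks p c \<union> asks (p + clen c) d"
| "asks p (While b c) = asks (Suc p) c"
| "asks p (Ask r) = {p}"

text \<open>Step counts are those of the compiled machine: a round of \<open>While\<close> pays one
  step for the test and one for the jump back, an \<open>Ask\<close> one to enter the query state,
  one for the query and one in the answer state.\<close>

inductive exec :: "nat \<Rightarrow> (nat \<Rightarrow> bool) \<Rightarrow> com \<Rightarrow> (nat \<Rightarrow> tape) \<Rightarrow> nat \<Rightarrow> (nat \<Rightarrow> tape) \<Rightarrow> bool"
  for n A where
  Act: "exec n A (Act f) T 1 (perform n f T)"
| Seq: "exec n A c T t T' \<Longrightarrow> exec n A d T' u T'' \<Longrightarrow> exec n A (Seq c d) T (t + u) T''"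
| While_False: "\<not> b (syms n T) \<Longrightarrow> exec n A (While b c) T 1 T"
| While_True: "b (syms n T) \<Longrightarrow> exec n A c T t T' \<Longrightarrow> exec n A (While b c) T' u T''
    \<Longrightarrow> exec n A (While b c) T (t + u + 2) T''"
| Ask_yes: "A (str_to_nat (query_word (map T [0..<n]))) \<Longrightarrow> exec n A (Ask r) T 3 T"
| Ask_no: "\<not> A (str_to_nat (query_word (map T [0..<n]))) \<Longrightarrow> exec n A (Ask r) T 3 (perform n (right r) T)"

lemma length_compile [simp]: "length (compile n Q p c) = clen c"
  by (induction c arbitrary: p) auto

lemma compile_instr:
  "I \<in> set (compile n Q p c) \<Longrightarrow>
     \<exists>f. snd (I ss) = actions n f ss \<and> (fst (I ss) \<le> p + clen c \<or> fst (I ss) = Q)"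
proof (induction c arbitrary: p)
  case (Seq c d)
  then consider "I \<in> set (compile n Q p c)" | "I \<in> set (compile n Q (p + clen c) d)" by auto
  then show ?case using Seq.IH by cases fastforce+
next
  case (While b c)
  then consider "I \<in> set (compile n Q (Suc p) c)"
    | "I = (\<lambda>ss. (if b ss then Suc p else p + clen c + 2, actions n stay ss))"
    | "I = (\<lambda>ss. (p, actions n stay ss))" by auto
  then show ?case using While.IH[of "Suc p"] by cases (fastforce, auto)
qed auto

lemma read_syms_map: "read_syms (map T [0..<n]) = syms n T"
  by (simp add: read_syms_def syms_def case_prod_beta)

lemma apply_acts: "map2 apply_act (map T [0..<n]) (actions n f (syms n T)) = map (perform n f T) [0..<n]"
  by (rule nth_equalityI) (auto simp: actions_def perform_def)

lemma perform_stay: "perform n stay T = T"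
proof
  fix i
  show "perform n stay T i = T i"
    by (cases "T i") (auto simp: perform_def sanitize_def move_def syms_def apply_act_def)
qed

text \<open>The induction is over the execution and not over the program, since a further round of
  \<open>While\<close> executes the same program at the same address. The address is generalized
  because subprograms sit at shifted addresses.\<close>

lemma exec_run:
  assumes "exec n A c T t T'"
    and "\<And>i ss. i < clen c \<Longrightarrow> delta M (p + i) ss = (compile n (q_query M) p c ! i) ss"
    and "\<And>i. i < clen c \<Longrightarrow> p + i \<notin> {q_accept M, q_reject M, q_query M}"
    and "q_query M \<notin> {q_accept M, q_reject M}"
    and "\<And>a. a \<in> asks p c \<Longrightarrow> q_yes M = Suc a \<and> q_no M = a + 2"
  shows "(step M A ^^ t) (p, map T [0..<n]) = (p + clen c, map T' [0..<n])"
  using assms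
proof (induction arbitrary: p rule: exec.induct)
  case (Act f T)
  from Act(1)[of 0] Act(2)[of 0] show ?case
    by (simp add: step_def read_syms_map apply_acts)
next
  case (Seq c T t T' d u T'')
  have 1: "(step M A ^^ t) (p, map T [0..<n]) = (p + clen c, map T' [0..<n])"
  proof (rule Seq.IH(1))
    show "delta M (p + i) ss = (compile n (q_query M) p c ! i) ss" if "i < clen c" for i ss
      using Seq.prems(1)[of i ss] that by (simp add: nth_append)
  qed (use Seq.prems(2)[simplified] Seq.prems(3,4) in auto)
  have 2: "(step M A ^^ u) (p + clen c, map T' [0..<n]) = (p + clen c + clen d, map T'' [0..<n])"
  proof (rule Seq.IH(2))
    show "delta M (p + clen c + i) ss = (compile n (q_query M) (p + clen c) d ! i) ss" if "i < clen d" for i ss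
      using Seq.prems(1)[of "clen c + i" ss] that by (simp add: nth_append add.assoc)
    show "p + clen c + i \<notin> {q_accept M, q_reject M, q_query M}" if "i < clen d" for i
      using Seq.prems(2)[of "clen c + i"] that by (simp add: add.assoc)
  qed (use Seq.prems(3,4) in auto)
  \<comment> \<open>\<open>funpow_add\<close> lets the right summand act first, so the earlier phase
    has to stand on the right.\<close>
  have "t + u = u + t" by simp
  show ?case unfolding \<open>t + u = u + t\<close> funpow_add by (simp add: 1 2 add.assoc)
next
  case (While_False b T c)
  from While_False(2)[of 0] While_False(3)[of 0] While_False(1) show ?case
    by (simp add: step_def read_syms_map apply_acts perform_stay)
next
  case (While_True b T c t T' u T'')
  have 1: "step M A (p, map T [0..<n]) = (Suc p, map T [0..<n])"
    using While_True.prems(1)[of 0] While_True.prems(2)[of 0] While_True.hyps(1)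
    by (simp add: step_def read_syms_map apply_acts perform_stay)
  have 2: "(step M A ^^ t) (Suc p, map T [0..<n]) = (Suc p + clen c, map T' [0..<n])"
  proof (rule While_True.IH(1))
    show "delta M (Suc p + i) ss = (compile n (q_query M) (Suc p) c ! i) ss" if "i < clen c" for i ss
      using While_True.prems(1)[of "Suc i" ss] that by (simp add: nth_append)
    show "Suc p + i \<notin> {q_accept M, q_reject M, q_query M}" if "i < clen c" for i
      using While_True.prems(2)[of "Suc i"] that by simp
  qed (use While_True.prems(3,4) in auto)
  have 3: "step M A (Suc p + clen c, map T' [0..<n]) = (p, map T' [0..<n])"
    using While_True.prems(1)[of "Suc (clen c)"] While_True.prems(2)[of "Suc (clen c)"]
    by (simp add: step_def read_syms_map apply_acts perform_stay nth_append)
  have 4: "(step M A ^^ u) (p, map T' [0..<n]) = (p + clen (While b c), map T'' [0..<n])"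
    by (rule While_True.IH(2)) (use While_True.prems in auto)
  have "t + u + 2 = u + (1 + (t + 1))" by simp
  show ?case unfolding \<open>t + u + 2 = u + (1 + (t + 1))\<close> funpow_add
    by (simp add: 1 2[simplified] 3[simplified] 4[simplified])
next
  case (Ask_yes T r)
  have q: "q_yes M = Suc p" using Ask_yes.prems(4)[of p] by simp
  have s: "step M A (p, map T [0..<n]) = (q_query M, map T [0..<n])"
    using Ask_yes.prems(1)[of 0] Ask_yes.prems(2)[of 0]
    by (simp add: step_def read_syms_map apply_acts perform_stay)
  have s2: "step M A (q_query M, map T [0..<n]) = (Suc p, map T [0..<n])"
    using Ask_yes.prems(3) Ask_yes.hyps q by (simp add: step_def)
  have s3: "step M A (Suc p, map T [0..<n]) = (p + 3, map T [0..<n])"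
    using Ask_yes.prems(1)[of 1] Ask_yes.prems(2)[of 1]
    by (simp add: step_def read_syms_map apply_acts perform_stay)
  show ?case using s s2 s3 by (simp add: numeral_3_eq_3)
next
  case (Ask_no T r)
  have q: "q_no M = p + 2" using Ask_no.prems(4)[of p] by simp
  have s: "step M A (p, map T [0..<n]) = (q_query M, map T [0..<n])"
    using Ask_no.prems(1)[of 0] Ask_no.prems(2)[of 0]
    by (simp add: step_def read_syms_map apply_acts perform_stay)
  have s2: "step M A (q_query M, map T [0..<n]) = (p + 2, map T [0..<n])"
    using Ask_no.prems(3) Ask_no.hyps q by (simp add: step_def)
  have s3: "step M A (p + 2, map T [0..<n]) = (p + 3, map (perform n (right r) T) [0..<n])"
    using Ask_no.prems(1)[of 2] Ask_no.prems(2)[of 2]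
    by (simp add: step_def read_syms_map apply_acts)
  show ?case using s s2 s3 by (simp add: numeral_3_eq_3 numeral_2_eq_2)
qed

text \<open>A machine has a single pair of answer states, so a program may contain only one
\<^const>\<open>Ask\<close>; \<open>a\<close> is its address. The machine accepts iff tape \<open>r\<close> does not scan the symbol 1.\<close>

definition machine :: "nat \<Rightarrow> com \<Rightarrow> nat \<Rightarrow> nat \<Rightarrow> tm" where
  "machine n c a r = \<lparr>ntapes = n, nstates = clen c + 4, nsyms = 3,
     delta = (\<lambda>q ss. if q < clen c then (compile n (clen c + 3) 0 c ! q) ss
       else (if ss ! r \<noteq> 1 then clen c + 1 else clen c + 2, actions n stay ss)),
     q_start = 0, q_accept = clen c + 1, q_reject = clen c + 2, q_query = clen c + 3,
     q_yes = Suc a, q_no = a + 2\<rparr>"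

lemma wf_machine:
  assumes "2 \<le> n" "a < clen c"
  shows "wf_tm (machine n c a r)"
proof -
  have acts: "length (actions n f ss) = n \<and> (\<forall>(s, m) \<in> set (actions n f ss). s < 3 \<and> m \<in> {-1, 0, 1})"
    if "length ss = n" "\<forall>s\<in>set ss. s < 3" for f ss
    using that by (auto simp: actions_def sanitize_def sgn_if)
  have "case delta (machine n c a r) q ss of (q', as) \<Rightarrow>
           q' < clen c + 4 \<and> length as = n \<and> (\<forall>(s, m) \<in> set as. s < 3 \<and> m \<in> {-1, 0, 1})"
    if ss: "length ss = n" "\<forall>s\<in>set ss. s < 3" for q ss
  proof (cases "q < clen c")
    case True
    then have "compile n (clen c + 3) 0 c ! q \<in> set (compile n (clen c + 3) 0 c)" by simp
    from compile_instr[OF this, of ss] obtain f where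
      "snd ((compile n (clen c + 3) 0 c ! q) ss) = actions n f ss"
      "fst ((compile n (clen c + 3) 0 c ! q) ss) \<le> clen c + 3" by auto
    with True acts[OF ss, of f] show ?thesis
      by (auto simp: machine_def case_prod_beta)
  next
    case False
    then show ?thesis using acts[OF ss, of stay] by (auto simp: machine_def)
  qed
  then show ?thesis using assms by (auto simp: wf_tm_def machine_def)
qed

text \<open>The one step beyond \<open>t\<close> leads from \<open>clen c\<close>, the exit of the
  program, to the verdict.\<close>

lemma machine_run:
  assumes "exec n A c T t T'" "asks 0 c \<subseteq> {a}" "map T [0..<n] = snd (init_config (machine n c a r) x)" "r < n"
  shows "fst (run (machine n c a r) A x (Suc t)) = (if fst (T' r) (snd (T' r)) \<noteq> 1
     then q_accept (machine n c a r) else q_reject (machine n c a r))"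
proof -
  let ?M = "machine n c a r"
  have "(step ?M A ^^ t) (0, map T [0..<n]) = (0 + clen c, map T' [0..<n])"
    by (rule exec_run[OF assms(1)]) (use assms(2) in \<open>auto simp: machine_def\<close>)
  moreover have "init_config ?M x = (0, map T [0..<n])"
    using assms(3) by (simp add: init_config_def machine_def)
  moreover have "syms n T' ! r = fst (T' r) (snd (T' r))"
    using assms(4) by (simp add: syms_def)
  ultimately show ?thesis
    by (simp add: run_def step_def read_syms_map) (simp add: machine_def)
qed

section \<open>Counters\<close>

text \<open>The mark in cell 0 makes the zero test local: a counter scans 1 iff its value is 0.
  Since a head at cell 0 cannot move further left, decrementing is truncated subtraction.\<close>

definition marker :: "nat \<Rightarrow> nat" where
  "marker j = (if j = 0 then 1 else 0)"

text \<open>From tape 2 on, a tape is a counter: its content stays \<^const>\<open>marker\<close>, and the head position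
is the value of the counter.\<close>

definition counters :: "(nat \<Rightarrow> tape) \<Rightarrow> (nat \<Rightarrow> nat) \<Rightarrow> nat \<Rightarrow> tape" where
  "counters T s = (\<lambda>i. if i < 2 then T i else (marker, s i))"

text \<open>The number of steps is left open: programs specified in this form run only on strings
  that are not fast, where termination is enough.\<close>

definition computes :: "nat \<Rightarrow> com \<Rightarrow> (nat \<Rightarrow> nat) \<Rightarrow> (nat \<Rightarrow> nat) \<Rightarrow> bool" where
  "computes n c s s' \<longleftrightarrow> (\<forall>A T. \<exists>t. exec n A c (counters T s) t (counters T s'))"

abbreviation "Inc r \<equiv> Act (right r)"
abbreviation "Dec r \<equiv> Act (left r)"
abbreviation "Loop r c \<equiv> While (\<lambda>ss. ss ! r \<noteq> 1) c"
abbreviation "Dec_or_Inc r q \<equiv> Act (\<lambda>ss. if ss ! r = 1 then right q ss else left r ss)"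
abbreviation "Clear r \<equiv> Loop r (Dec r)"
abbreviation "Move r q \<equiv> Loop r (Seq (Dec r) (Inc q))"

lemma syms_counters: "2 \<le> r \<Longrightarrow> r < n \<Longrightarrow> syms n (counters T s) ! r = marker (s r)"
  by (simp add: syms_def counters_def)

lemma syms_nth: "i < n \<Longrightarrow> syms n T ! i = fst (T i) (snd (T i))"
  by (simp add: syms_def)

lemma perform_right: "r < n \<Longrightarrow> perform n (right r) T = T(r := (fst (T r), Suc (snd (T r))))"
  by (rule ext) (auto simp: perform_def sanitize_def move_def syms_nth apply_act_def case_prod_beta nat_add_distrib)

lemma perform_left: "r < n \<Longrightarrow> perform n (left r) T = T(r := (fst (T r), snd (T r) - 1))"
  by (rule ext) (auto simp: perform_def sanitize_def move_def syms_nth apply_act_def case_prod_beta nat_diff_distrib)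

lemma perform_right_counters:
  "2 \<le> r \<Longrightarrow> r < n \<Longrightarrow> perform n (right r) (counters T s) = counters T (s(r := Suc (s r)))"
  by (subst perform_right) (auto simp: counters_def)

lemma perform_left_counters:
  "2 \<le> r \<Longrightarrow> r < n \<Longrightarrow> perform n (left r) (counters T s) = counters T (s(r := s r - 1))"
  by (subst perform_left) (auto simp: counters_def)

lemma computes_Act: "(\<And>T. perform n f (counters T s) = counters T s') \<Longrightarrow> computes n (Act f) s s'"
  unfolding computes_def by (metis exec.Act)

lemma computes_Inc: "2 \<le> r \<Longrightarrow> r < n \<Longrightarrow> s' = s(r := Suc (s r)) \<Longrightarrow> computes n (Inc r) s s'"
  by (rule computes_Act) (simp add: perform_right_counters)

lemma computes_Dec: "2 \<le> r \<Longrightarrow> r < n \<Longrightarrow> s' = s(r := s r - 1) \<Longrightarrow> computes n (Dec r) s s'"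
  by (rule computes_Act) (simp add: perform_left_counters)

lemma computes_Dec_or_Inc:
  assumes "2 \<le> r" "r < n" "2 \<le> q" "q < n"
    and "s' = (if s r = 0 then s(q := Suc (s q)) else s(r := s r - 1))"
  shows "computes n (Dec_or_Inc r q) s s'"
proof -
  have "perform n (\<lambda>ss. if ss ! r = 1 then right q ss else left r ss) (counters T s) = counters T s'" for T
  proof (cases "s r = 0")
    case True
    then have "perform n (\<lambda>ss. if ss ! r = 1 then right q ss else left r ss) (counters T s)
      = perform n (right q) (counters T s)"
      using assms by (auto simp: perform_def syms_counters marker_def fun_eq_iff)
    then show ?thesis using assms True by (simp add: perform_right_counters)
  next
    case False
    then have "perform n (\<lambda>ss. if ss ! r = 1 then right q ss else left r ss) (counters T s)
      = perform n (left r) (counters T s)"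
      using assms by (auto simp: perform_def syms_counters marker_def fun_eq_iff)
    then show ?thesis using assms False by (simp add: perform_left_counters)
  qed
  then show ?thesis by (rule computes_Act)
qed

lemma computes_Seq: "computes n c s s' \<Longrightarrow> computes n d s' s'' \<Longrightarrow> computes n (Seq c d) s s''"
  unfolding computes_def by (blast intro: exec.Seq)

text \<open>Instead of an invariant, the whole trajectory is supplied: \<open>S k\<close> is the
  store at the moment when counter \<open>r\<close> has the value \<open>k\<close>.\<close>

lemma computes_Loop:
  assumes "\<And>k. S k r = k" "\<And>k. k < m \<Longrightarrow> computes n c (S (Suc k)) (S k)" "S m = s" "s' = S 0" "2 \<le> r" "r < n"
  shows "computes n (Loop r c) s s'"
proof -
  have "computes n (Loop r c) (S k) (S 0)" if "k \<le> m" for k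
    using that
  proof (induction k)
    case 0
    have "\<not> syms n (counters T (S 0)) ! r \<noteq> 1" for T
      using assms by (simp add: syms_counters marker_def)
    then show ?case unfolding computes_def by (blast intro: exec.While_False)
  next
    case (Suc k)
    have "syms n (counters T (S (Suc k))) ! r \<noteq> 1" for T
      using assms by (simp add: syms_counters marker_def)
    moreover have "computes n c (S (Suc k)) (S k)" "computes n (Loop r c) (S k) (S 0)"
      using Suc assms(2) by auto
    ultimately show ?case unfolding computes_def by (blast intro: exec.While_True)
  qed
  then show ?thesis using assms(3,4) by blast
qed

lemma computes_Clear: "2 \<le> r \<Longrightarrow> r < n \<Longrightarrow> s' = s(r := 0) \<Longrightarrow> computes n (Clear r) s s'"
  by (rule computes_Loop[where S = "\<lambda>k. s(r := k)" and m = "s r"], simp, rule computes_Dec) simp_all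

lemma computes_Dec_Inc:
  assumes "2 \<le> r" "r < n" "2 \<le> q" "q < n" "r \<noteq> q" "s' = s(r := s r - 1, q := Suc (s q))"
  shows "computes n (Seq (Dec r) (Inc q)) s s'"
  by (rule computes_Seq[OF computes_Dec[OF _ _ refl] computes_Inc]) (use assms in simp_all)

lemma computes_Dec_Inc_Inc:
  assumes "2 \<le> r" "r < n" "2 \<le> q" "q < n" "2 \<le> w" "w < n" "distinct [r, q, w]"
    and "s' = s(r := s r - 1, q := Suc (s q), w := Suc (s w))"
  shows "computes n (Seq (Dec r) (Seq (Inc q) (Inc w))) s s'"
  by (rule computes_Seq[OF computes_Dec[OF _ _ refl] computes_Seq[OF computes_Inc[OF _ _ refl] computes_Inc]])
     (use assms in simp_all)

lemma computes_Move:
  "2 \<le> r \<Longrightarrow> r < n \<Longrightarrow> 2 \<le> q \<Longrightarrow> q < n \<Longrightarrow> r \<noteq> q \<Longrightarrow> s' = s(r := 0, q := s q + s r) \<Longrightarrow> computes n (Move r q) s s'"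
  by (rule computes_Loop[where S = "\<lambda>k. s(r := k, q := s q + (s r - k))" and m = "s r"], simp,
       rule computes_Dec_Inc) (auto simp: fun_eq_iff)

text \<open>A counter can be read only by running it down, so \<open>w\<close> collects a second
  copy from which \<open>r\<close> is restored.\<close>

definition Copy :: "nat \<Rightarrow> nat \<Rightarrow> nat \<Rightarrow> com" where
  "Copy r q w = Seq (Loop r (Seq (Dec r) (Seq (Inc q) (Inc w)))) (Move w r)"

lemma computes_Copy:
  assumes "2 \<le> r" "r < n" "2 \<le> q" "q < n" "2 \<le> w" "w < n" "distinct [r, q, w]" "s w = 0"
    and "s' = s(q := s q + s r)"
  shows "computes n (Copy r q w) s s'"
  unfolding Copy_def
proof (rule computes_Seq)
  show "computes n (Loop r (Seq (Dec r) (Seq (Inc q) (Inc w)))) s (s(r := 0, q := s q + s r, w := s r))"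
    by (rule computes_Loop[where S = "\<lambda>k. s(r := k, q := s q + (s r - k), w := s r - k)" and m = "s r", OF _ computes_Dec_Inc_Inc])
       (use assms in \<open>auto simp: fun_eq_iff\<close>)
  show "computes n (Move w r) (s(r := 0, q := s q + s r, w := s r)) s'"
    by (rule computes_Move) (use assms in \<open>auto simp: fun_eq_iff\<close>)
qed

text \<open>Follows \<open>prod_encode (u, v) = triangle (u + v) + u\<close>. Counter
  \<open>b\<close> receives \<open>u\<close> while counter \<open>b + 2\<close> grows to
  \<open>t = u + v\<close>; then \<open>t\<close>, \<open>t - 1\<close>, ..., 1 are added to
  \<open>b\<close>.\<close>

definition Encode :: "nat \<Rightarrow> com" where
  "Encode b = Seq (Clear b) (Seq
     (Loop (b + 1) (Seq (Dec (b + 1)) (Seq (Inc b) (Inc (b + 2)))))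
     (Loop (b + 2) (Seq (Seq (Loop (b + 2) (Seq (Dec (b + 2)) (Seq (Inc b) (Inc (b + 3)))))
        (Move (b + 3) (b + 2))) (Dec (b + 2)))))"

lemma triangle_mono: "m \<le> n \<Longrightarrow> triangle m \<le> triangle n"
  by (induction n) (auto simp: le_Suc_eq)

lemma computes_Encode:
  assumes "2 \<le> b" "b + 3 < n" "s (b + 3) = 0"
    and "s' = s(b := prod_encode (s (b + 1), s (b + 2)), b + 1 := 0, b + 2 := 0)"
  shows "computes n (Encode b) s s'"
  unfolding Encode_def
proof (intro computes_Seq)
  let ?u = "s (b + 1)" and ?v = "s (b + 2)"
  let ?t = "?u + ?v"
  show "computes n (Clear b) s (s(b := 0))"
    by (rule computes_Clear) (use assms in simp_all)
  show "computes n (Loop (b + 1) (Seq (Dec (b + 1)) (Seq (Inc b) (Inc (b + 2))))) (s(b := 0))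
     (s(b := ?u, b + 1 := 0, b + 2 := ?t))"
    by (rule computes_Loop[where S = "\<lambda>k. s(b := ?u - k, b + 1 := k, b + 2 := ?t - k)" and m = ?u, OF _ computes_Dec_Inc_Inc])
       (use assms in \<open>auto simp: fun_eq_iff\<close>)
  show "computes n (Loop (b + 2) (Seq (Seq (Loop (b + 2) (Seq (Dec (b + 2)) (Seq (Inc b) (Inc (b + 3)))))
        (Move (b + 3) (b + 2))) (Dec (b + 2)))) (s(b := ?u, b + 1 := 0, b + 2 := ?t)) s'"
  proof (rule computes_Loop[where m = ?t and
      S = "\<lambda>k. s(b := ?u + (triangle ?t - triangle k), b + 1 := 0, b + 2 := k)"])
    fix k assume k: "k < ?t"
    let ?S = "\<lambda>k. s(b := ?u + (triangle ?t - triangle k), b + 1 := 0, b + 2 := k)"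
    have tri: "triangle (Suc k) \<le> triangle ?t" using k by (intro triangle_mono) auto
    show "computes n (Seq (Seq (Loop (b + 2) (Seq (Dec (b + 2)) (Seq (Inc b) (Inc (b + 3)))))
        (Move (b + 3) (b + 2))) (Dec (b + 2))) (?S (Suc k)) (?S k)"
    proof (intro computes_Seq)
      let ?x = "?u + (triangle ?t - triangle (Suc k))"
      show "computes n (Loop (b + 2) (Seq (Dec (b + 2)) (Seq (Inc b) (Inc (b + 3))))) (?S (Suc k))
         (s(b := ?x + Suc k, b + 1 := 0, b + 2 := 0, b + 3 := Suc k))"
        by (rule computes_Loop[where m = "Suc k" and
            S = "\<lambda>j. s(b := ?x + (Suc k - j), b + 1 := 0, b + 2 := j, b + 3 := Suc k - j)", OF _ computes_Dec_Inc_Inc])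
           (use assms in \<open>auto simp: fun_eq_iff Suc_diff_le\<close>)
      show "computes n (Move (b + 3) (b + 2)) (s(b := ?x + Suc k, b + 1 := 0, b + 2 := 0, b + 3 := Suc k))
         (s(b := ?x + Suc k, b + 1 := 0, b + 2 := Suc k))"
        by (rule computes_Move) (use assms in \<open>auto simp: fun_eq_iff\<close>)
      show "computes n (Dec (b + 2)) (s(b := ?x + Suc k, b + 1 := 0, b + 2 := Suc k)) (?S k)"
        by (rule computes_Dec) (use assms tri in \<open>auto simp: fun_eq_iff\<close>)
    qed
  qed (use assms in \<open>auto simp: fun_eq_iff prod_encode_def\<close>)
qed

text \<open>Walks through the pairs in the order of their codes: \<open>(u, v)\<close> is followed
  by \<open>(u + 1, v - 1)\<close>, or by \<open>(0, u + 1)\<close> if \<open>v = 0\<close>. Counter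
  \<open>b + 3\<close> is a flag for the second case, raised by \<open>Dec_or_Inc\<close> when there
  is nothing to decrement.\<close>

definition Decode :: "nat \<Rightarrow> com" where
  "Decode b = Loop b (Seq (Dec b) (Seq (Inc (b + 1)) (Seq (Dec_or_Inc (b + 2) (b + 3))
     (Loop (b + 3) (Seq (Dec (b + 3)) (Move (b + 1) (b + 2)))))))"

lemma prod_decode_0: "prod_decode 0 = (0, 0)"
  using prod_encode_inverse[of "(0, 0)"] by (simp add: prod_encode_def)

lemma prod_decode_Suc:
  "prod_decode (Suc m) = (case prod_decode m of (u, v) \<Rightarrow> if v = 0 then (0, Suc u) else (Suc u, v - 1))"
proof -
  obtain u v where uv: "prod_decode m = (u, v)" by force
  then have "m = prod_encode (u, v)" by (metis prod_decode_inverse)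
  then have "Suc m = prod_encode (if v = 0 then (0, Suc u) else (Suc u, v - 1))"
    by (cases v) (auto simp: prod_encode_def)
  then show ?thesis using uv by (simp only: prod_encode_inverse) simp
qed

lemma computes_Decode:
  assumes "2 \<le> b" "b + 3 < n" "s (b + 1) = 0" "s (b + 2) = 0" "s (b + 3) = 0"
    and "s' = s(b := 0, b + 1 := fst (prod_decode (s b)), b + 2 := snd (prod_decode (s b)))"
  shows "computes n (Decode b) s s'"
  unfolding Decode_def
proof (rule computes_Loop[where m = "s b" and
    S = "\<lambda>k. s(b := k, b + 1 := fst (prod_decode (s b - k)), b + 2 := snd (prod_decode (s b - k)))"])
  let ?S = "\<lambda>k. s(b := k, b + 1 := fst (prod_decode (s b - k)), b + 2 := snd (prod_decode (s b - k)))"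
  fix k assume k: "k < s b"
  obtain u v where uv: "prod_decode (s b - Suc k) = (u, v)" by force
  have "s b - k = Suc (s b - Suc k)" using k by simp
  then have suc: "prod_decode (s b - k) = (if v = 0 then (0, Suc u) else (Suc u, v - 1))"
    using uv by (simp add: prod_decode_Suc)
  let ?s1 = "s(b := k, b + 1 := Suc u, b + 2 := v)"
  let ?s2 = "s(b := k, b + 1 := Suc u, b + 2 := v - 1, b + 3 := (if v = 0 then 1 else 0))"
  show "computes n (Seq (Dec b) (Seq (Inc (b + 1)) (Seq (Dec_or_Inc (b + 2) (b + 3))
     (Loop (b + 3) (Seq (Dec (b + 3)) (Move (b + 1) (b + 2))))))) (?S (Suc k)) (?S k)"
  proof (intro computes_Seq)
    show "computes n (Dec b) (?S (Suc k)) (s(b := k, b + 1 := u, b + 2 := v))"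
      by (rule computes_Dec) (use assms uv in \<open>auto simp: fun_eq_iff\<close>)
    show "computes n (Inc (b + 1)) (s(b := k, b + 1 := u, b + 2 := v)) ?s1"
      by (rule computes_Inc) (use assms in \<open>auto simp: fun_eq_iff\<close>)
    show "computes n (Dec_or_Inc (b + 2) (b + 3)) ?s1 ?s2"
      by (rule computes_Dec_or_Inc) (use assms in \<open>auto simp: fun_eq_iff\<close>)
    show "computes n (Loop (b + 3) (Seq (Dec (b + 3)) (Move (b + 1) (b + 2)))) ?s2 (?S k)"
    proof (cases "v = 0")
      case True
      show ?thesis
        by (rule computes_Loop[where m = 1 and
             S = "\<lambda>j. s(b := k, b + 1 := j * Suc u, b + 2 := (1 - j) * Suc u, b + 3 := j)", OF _ computes_Seq[OF computes_Dec[OF _ _ refl] computes_Move]])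
           (use assms True suc in \<open>auto simp: fun_eq_iff\<close>)
    next
      case False
      show ?thesis
        by (rule computes_Loop[where m = 0 and S = "\<lambda>j. ?s2(b + 3 := j)"])
           (use assms False suc in \<open>auto simp: fun_eq_iff\<close>)
    qed
  qed
qed (use assms in \<open>auto simp: fun_eq_iff prod_decode_0\<close>)

section \<open>Primitive recursive functions\<close>

abbreviation "pfst z \<equiv> fst (prod_decode z)"
abbreviation "psnd z \<equiv> snd (prod_decode z)"
abbreviation "pair a b \<equiv> prod_encode (a, b)"

text \<open>The program \<open>P b\<close> replaces the value of counter \<open>b\<close> by its image under \<open>f\<close>, using
the next \<open>d\<close> counters as scratch space, which is clear before and after.\<close>

definition pr :: "(nat \<Rightarrow> nat) \<Rightarrow> bool" where
  "pr f \<longleftrightarrow> (\<exists>P d. (\<forall>b p. asks p (P b) = {}) \<and>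
     (\<forall>n b s. 2 \<le> b \<longrightarrow> b + d < n \<longrightarrow> (\<forall>i>b. s i = 0) \<longrightarrow> computes n (P b) s (s(b := f (s b)))))"

definition prp :: "(nat \<Rightarrow> bool) \<Rightarrow> bool" where
  "prp P \<longleftrightarrow> pr (\<lambda>x. if P x then 1 else 0)"

lemma prI:
  assumes "\<And>b p. asks p (P b) = {}"
    and "\<And>n b s. 2 \<le> b \<Longrightarrow> b + d < n \<Longrightarrow> \<forall>i>b. s i = 0 \<Longrightarrow> computes n (P b) s (s(b := f (s b)))"
  shows "pr f"
  unfolding pr_def by (intro exI[of _ P] exI[of _ d] conjI, (rule allI assms(1))+,
      intro allI impI, rule assms(2); assumption)

lemma prE:
  assumes "pr f"
  obtains P d where "\<And>b p. asks p (P b) = {}"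
    "\<And>n b s s'. 2 \<le> b \<Longrightarrow> b + d < n \<Longrightarrow> \<forall>i>b. s i = 0 \<Longrightarrow> s' = s(b := f (s b)) \<Longrightarrow> computes n (P b) s s'"
proof -
  from assms[unfolded pr_def] obtain P d where "\<forall>b p. asks p (P b) = {}"
    and P: "\<forall>n b s. 2 \<le> b \<longrightarrow> b + d < n \<longrightarrow> (\<forall>i>b. s i = 0) \<longrightarrow> computes n (P b) s (s(b := f (s b)))"
    by (elim exE conjE)
  then have "asks p (P b) = {}" for b p by (elim allE)
  moreover have "computes n (P b) s s'" if "2 \<le> b" "b + d < n" "\<forall>i>b. s i = 0" "s' = s(b := f (s b))" for n b s s'
    unfolding that(4) by (rule P[rule_format, OF that(1,2)]) (rule that(3)[rule_format])
  ultimately show thesis by (rule that)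
qed

lemma pr_id: "pr (\<lambda>x. x)"
  by (rule prI[where P = "\<lambda>b. Seq (Inc b) (Dec b)" and d = 0])
     (simp_all add: computes_Seq[OF computes_Inc[OF _ _ refl] computes_Dec])

lemma pr_zero: "pr (\<lambda>x. 0)"
  by (rule prI[where P = "\<lambda>b. Clear b" and d = 0], simp, rule computes_Clear) simp_all

lemma pr_comp:
  assumes "pr g" "pr f"
  shows "pr (\<lambda>x. g (f x))"
proof -
  from \<open>pr f\<close> obtain P d where P: "\<And>b p. asks p (P b) = {}"
    "\<And>n b s s'. 2 \<le> b \<Longrightarrow> b + d < n \<Longrightarrow> \<forall>i>b. s i = 0 \<Longrightarrow> s' = s(b := f (s b)) \<Longrightarrow> computes n (P b) s s'"
    by (rule prE) blast
  from \<open>pr g\<close> obtain P' d' where P': "\<And>b p. asks p (P' b) = {}"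
    "\<And>n b s s'. 2 \<le> b \<Longrightarrow> b + d' < n \<Longrightarrow> \<forall>i>b. s i = 0 \<Longrightarrow> s' = s(b := g (s b)) \<Longrightarrow> computes n (P' b) s s'"
    by (rule prE) blast
  show ?thesis
  proof (rule prI[where P = "\<lambda>b. Seq (P b) (P' b)" and d = "d + d'"])
    fix n b :: nat and s :: "nat \<Rightarrow> nat"
    assume "2 \<le> b" "b + (d + d') < n" "\<forall>i>b. s i = 0"
    then show "computes n (Seq (P b) (P' b)) s (s(b := g (f (s b))))"
      by (intro computes_Seq[OF P(2)[OF _ _ _ refl] P'(2)]) auto
  qed (simp add: P P')
qed

lemma pr_Suc: "pr f \<Longrightarrow> pr (\<lambda>x. Suc (f x))"
  by (rule pr_comp[of Suc], rule prI[where P = "\<lambda>b. Inc b" and d = 0]) (simp_all add: computes_Inc)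

lemma pr_const: "pr (\<lambda>x. c)"
  by (induction c) (simp_all add: pr_zero pr_Suc)

lemma pr_pfst: "pr f \<Longrightarrow> pr (\<lambda>x. pfst (f x))"
proof (rule pr_comp[of pfst], rule prI[where P = "\<lambda>b. Seq (Decode b) (Seq (Clear (b + 2)) (Move (b + 1) b))" and d = 3])
  fix n b :: nat and s :: "nat \<Rightarrow> nat"
  assume *: "2 \<le> b" "b + 3 < n" "\<forall>i>b. s i = 0"
  show "computes n (Seq (Decode b) (Seq (Clear (b + 2)) (Move (b + 1) b))) s (s(b := pfst (s b)))"
    by (intro computes_Seq[OF computes_Decode[OF _ _ _ _ _ refl] computes_Seq[OF computes_Clear[OF _ _ refl]
       computes_Move]]) (use * in \<open>auto simp: fun_eq_iff\<close>)
qed (auto simp: Decode_def)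

lemma pr_psnd: "pr f \<Longrightarrow> pr (\<lambda>x. psnd (f x))"
proof (rule pr_comp[of psnd], rule prI[where P = "\<lambda>b. Seq (Decode b) (Seq (Clear (b + 1)) (Move (b + 2) b))" and d = 3])
  fix n b :: nat and s :: "nat \<Rightarrow> nat"
  assume *: "2 \<le> b" "b + 3 < n" "\<forall>i>b. s i = 0"
  show "computes n (Seq (Decode b) (Seq (Clear (b + 1)) (Move (b + 2) b))) s (s(b := psnd (s b)))"
    by (intro computes_Seq[OF computes_Decode[OF _ _ _ _ _ refl] computes_Seq[OF computes_Clear[OF _ _ refl]
       computes_Move]]) (use * in \<open>auto simp: fun_eq_iff\<close>)
qed (auto simp: Decode_def)

lemma pr_pair:
  assumes "pr f" "pr g"
  shows "pr (\<lambda>x. pair (f x) (g x))"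
proof -
  from \<open>pr f\<close> obtain P d where P: "\<And>b p. asks p (P b) = {}"
    "\<And>n b s s'. 2 \<le> b \<Longrightarrow> b + d < n \<Longrightarrow> \<forall>i>b. s i = 0 \<Longrightarrow> s' = s(b := f (s b)) \<Longrightarrow> computes n (P b) s s'"
    by (rule prE) blast
  from \<open>pr g\<close> obtain P' d' where P': "\<And>b p. asks p (P' b) = {}"
    "\<And>n b s s'. 2 \<le> b \<Longrightarrow> b + d' < n \<Longrightarrow> \<forall>i>b. s i = 0 \<Longrightarrow> s' = s(b := g (s b)) \<Longrightarrow> computes n (P' b) s s'"
    by (rule prE) blast
  let ?P = "\<lambda>b. Seq (Copy b (b + 1) (b + 2)) (Seq (P (b + 1)) (Seq (Copy b (b + 2) (b + 3)) (Seq (P' (b + 2)) (Encode b))))"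
  show ?thesis
  proof (rule prI[where P = ?P and d = "d + d' + 3"])
    fix n b :: nat and s :: "nat \<Rightarrow> nat"
    assume *: "2 \<le> b" "b + (d + d' + 3) < n" "\<forall>i>b. s i = 0"
    show "computes n (?P b) s (s(b := pair (f (s b)) (g (s b))))"
    proof (intro computes_Seq)
      show "computes n (Copy b (b + 1) (b + 2)) s (s(b + 1 := s b))"
        by (rule computes_Copy) (use * in \<open>auto simp: fun_eq_iff\<close>)
      show "computes n (P (b + 1)) (s(b + 1 := s b)) (s(b + 1 := f (s b)))"
        by (rule P(2)) (use * in \<open>auto simp: fun_eq_iff\<close>)
      show "computes n (Copy b (b + 2) (b + 3)) (s(b + 1 := f (s b))) (s(b + 1 := f (s b), b + 2 := s b))"
        by (rule computes_Copy) (use * in \<open>auto simp: fun_eq_iff\<close>)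
      show "computes n (P' (b + 2)) (s(b + 1 := f (s b), b + 2 := s b)) (s(b + 1 := f (s b), b + 2 := g (s b)))"
        by (rule P'(2)) (use * in \<open>auto simp: fun_eq_iff\<close>)
      show "computes n (Encode b) (s(b + 1 := f (s b), b + 2 := g (s b))) (s(b := pair (f (s b)) (g (s b))))"
        by (rule computes_Encode) (use * in \<open>auto simp: fun_eq_iff\<close>)
    qed
  qed (simp add: P P' Copy_def Encode_def)
qed

text \<open>The only recursion scheme that is programmed. Iteration with a parameter and primitive
  recursion reduce to it by carrying the parameter, or the stage, along in a pair.\<close>

lemma pr_funpow:
  assumes "pr g"
  shows "pr (\<lambda>x. (g ^^ psnd x) (pfst x))"
proof -
  from \<open>pr g\<close> obtain P d where P: "\<And>b p. asks p (P b) = {}"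
    "\<And>n b s s'. 2 \<le> b \<Longrightarrow> b + d < n \<Longrightarrow> \<forall>i>b. s i = 0 \<Longrightarrow> s' = s(b := g (s b)) \<Longrightarrow> computes n (P b) s s'"
    by (rule prE) blast
  let ?P = "\<lambda>b. Seq (Decode b) (Seq (Move (b + 2) b) (Seq (Loop b (Seq (Dec b) (P (b + 1)))) (Move (b + 1) b)))"
  show ?thesis
  proof (rule prI[where P = ?P and d = "d + 3"])
    fix n b :: nat and s :: "nat \<Rightarrow> nat"
    assume *: "2 \<le> b" "b + (d + 3) < n" "\<forall>i>b. s i = 0"
    let ?u = "pfst (s b)" and ?v = "psnd (s b)"
    show "computes n (?P b) s (s(b := (g ^^ ?v) ?u))"
    proof (intro computes_Seq)
      show "computes n (Decode b) s (s(b := 0, b + 1 := ?u, b + 2 := ?v))"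
        by (rule computes_Decode) (use * in \<open>auto simp: fun_eq_iff\<close>)
      show "computes n (Move (b + 2) b) (s(b := 0, b + 1 := ?u, b + 2 := ?v)) (s(b := ?v, b + 1 := ?u))"
        by (rule computes_Move) (use * in \<open>auto simp: fun_eq_iff\<close>)
      show "computes n (Loop b (Seq (Dec b) (P (b + 1)))) (s(b := ?v, b + 1 := ?u)) (s(b := 0, b + 1 := (g ^^ ?v) ?u))"
      proof (rule computes_Loop[where S = "\<lambda>k. s(b := k, b + 1 := (g ^^ (?v - k)) ?u)" and m = ?v])
        fix k assume "k < ?v"
        then have "?v - k = Suc (?v - Suc k)" by simp
        then have eq: "(g ^^ (?v - k)) ?u = g ((g ^^ (?v - Suc k)) ?u)" by simp
        show "computes n (Seq (Dec b) (P (b + 1))) (s(b := Suc k, b + 1 := (g ^^ (?v - Suc k)) ?u))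
           (s(b := k, b + 1 := (g ^^ (?v - k)) ?u))"
          unfolding eq by (rule computes_Seq[OF computes_Dec[OF _ _ refl] P(2)]) (use * in \<open>auto simp: fun_eq_iff\<close>)
      qed (use * in \<open>auto simp: fun_eq_iff\<close>)
      show "computes n (Move (b + 1) b) (s(b := 0, b + 1 := (g ^^ ?v) ?u)) (s(b := (g ^^ ?v) ?u))"
        by (rule computes_Move) (use * in \<open>auto simp: fun_eq_iff\<close>)
    qed
  qed (simp add: P Decode_def)
qed

lemma pr_iter:
  assumes "pr a" "pr k" "pr (\<lambda>z. G (pfst z) (psnd z))"
  shows "pr (\<lambda>x. (G x ^^ k x) (a x))"
proof -
  let ?h = "\<lambda>z. pair (pfst z) (G (pfst z) (psnd z))"
  have it: "(?h ^^ m) (pair x r) = pair x ((G x ^^ m) r)" for m x r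
    by (induction m) auto
  have "pr (\<lambda>x. psnd ((?h ^^ psnd (pair (pair x (a x)) (k x))) (pfst (pair (pair x (a x)) (k x)))))"
    by (rule pr_psnd, rule pr_comp[OF pr_funpow[of ?h]]) (intro pr_pair pr_pfst pr_id assms)+
  then show ?thesis by (simp add: it)
qed

lemma pr_rec:
  assumes "pr a" "pr k" "pr (\<lambda>z. G (pfst z) (pfst (psnd z)) (psnd (psnd z)))"
  shows "pr (\<lambda>x. rec_nat (a x) (G x) (k x))"
proof -
  let ?h = "\<lambda>x w. pair (Suc (pfst w)) (G x (pfst w) (psnd w))"
  have it: "(?h x ^^ m) (pair 0 r) = pair m (rec_nat r (G x) m)" for m x r
    by (induction m) auto
  have "pr (\<lambda>x. psnd ((?h x ^^ k x) (pair 0 (a x))))"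
    by (rule pr_psnd, rule pr_iter) (intro pr_pair pr_Suc pr_pfst pr_psnd pr_id pr_const assms)+
  then show ?thesis by (simp add: it)
qed

lemmas pr_basic = pr_id pr_const pr_Suc pr_pfst pr_psnd pr_pair pr_iter pr_rec

section \<open>Arithmetic, case distinctions and bounded quantifiers\<close>

lemma pr_add: "pr f \<Longrightarrow> pr g \<Longrightarrow> pr (\<lambda>x. f x + g x)"
proof -
  have "rec_nat a (\<lambda>_. Suc) b = a + b" for a b by (induction b) auto
  then show "pr f \<Longrightarrow> pr g \<Longrightarrow> ?thesis"
    using pr_rec[of f g "\<lambda>_ _. Suc"] by (simp add: pr_basic)
qed

lemma pr_diff: "pr f \<Longrightarrow> pr g \<Longrightarrow> pr (\<lambda>x. f x - g x)"
proof -
  assume f: "pr f" and g: "pr g"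
  have pred: "rec_nat 0 (\<lambda>i _. i) b = b - 1" for b by (cases b) auto
  have "rec_nat a (\<lambda>_ r. rec_nat 0 (\<lambda>i _. i) r) b = a - b" for a b by (induction b) (auto simp: pred)
  moreover have "pr (\<lambda>x. rec_nat (f x) (\<lambda>_ r. rec_nat 0 (\<lambda>i _. i) r) (g x))"
    by (intro pr_basic f g)
  ultimately show ?thesis by simp
qed

lemma pr_mult: "pr f \<Longrightarrow> pr g \<Longrightarrow> pr (\<lambda>x. f x * g x)"
proof -
  assume f: "pr f" and g: "pr g"
  have "rec_nat 0 (\<lambda>_ r. r + a) b = a * b" for a b :: nat by (induction b) auto
  moreover have "pr (\<lambda>x. rec_nat 0 (\<lambda>_ r. r + f x) (g x))"
    by (intro pr_basic pr_add f g pr_comp[OF f])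
  ultimately show ?thesis by simp
qed

lemma pr_power: "pr f \<Longrightarrow> pr g \<Longrightarrow> pr (\<lambda>x. f x ^ g x)"
proof -
  assume f: "pr f" and g: "pr g"
  have "rec_nat 1 (\<lambda>_ r. r * a) b = a ^ b" for a b :: nat by (induction b) auto
  moreover have "pr (\<lambda>x. rec_nat 1 (\<lambda>_ r. r * f x) (g x))"
    by (intro pr_basic pr_mult f g pr_comp[OF f])
  ultimately show ?thesis by simp
qed

lemma pr_mod2: "pr f \<Longrightarrow> pr (\<lambda>x. f x mod 2)"
proof -
  assume f: "pr f"
  have "rec_nat 0 (\<lambda>_ r. 1 - r) b = b mod 2" for b :: nat by (induction b) (auto simp: mod_Suc)
  moreover have "pr (\<lambda>x. rec_nat 0 (\<lambda>_ r. 1 - r) (f x))" by (intro pr_basic pr_diff f)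
  ultimately show ?thesis by simp
qed

lemma pr_div2: "pr f \<Longrightarrow> pr (\<lambda>x. f x div 2)"
proof -
  assume f: "pr f"
  have "rec_nat 0 (\<lambda>i r. r + i mod 2) b = b div 2" for b :: nat
    by (induction b) (auto, presburger)
  moreover have "pr (\<lambda>x. rec_nat 0 (\<lambda>i r. r + i mod 2) (f x))" by (intro pr_basic pr_add pr_mod2 f)
  ultimately show ?thesis by simp
qed

lemma pr_if: "prp P \<Longrightarrow> pr f \<Longrightarrow> pr g \<Longrightarrow> pr (\<lambda>x. if P x then f x else g x)"
proof -
  assume P: "prp P" and f: "pr f" and g: "pr g"
  have "pr (\<lambda>x. rec_nat (g x) (\<lambda>_ _. f x) (if P x then 1 else 0))"
    using P unfolding prp_def by (intro pr_basic g pr_comp[OF f])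
  then show ?thesis by (simp add: if_distrib cong: if_cong)
qed

lemma prp_zero: "pr f \<Longrightarrow> prp (\<lambda>x. f x = 0)"
proof -
  assume f: "pr f"
  have "(\<lambda>x. if f x = 0 then 1 else 0) = (\<lambda>x. 1 - f x)" by auto
  then show ?thesis unfolding prp_def using pr_diff[OF pr_const[of 1] f] by simp
qed

lemma prp_const: "prp (\<lambda>_. c)"
  by (simp add: prp_def pr_const)

lemma prp_not: "prp P \<Longrightarrow> prp (\<lambda>x. \<not> P x)"
proof -
  assume "prp P"
  then have "prp (\<lambda>x. (if P x then 1 else 0) = (0::nat))" unfolding prp_def[of P] by (rule prp_zero)
  moreover have "(\<lambda>x. (if P x then 1 else 0) = (0::nat)) = (\<lambda>x. \<not> P x)" by auto
  ultimately show ?thesis by simp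
qed

lemma prp_conj: "prp P \<Longrightarrow> prp Q \<Longrightarrow> prp (\<lambda>x. P x \<and> Q x)"
  unfolding prp_def by (drule (1) pr_mult, erule back_subst[of pr]) auto

lemma prp_disj: "prp P \<Longrightarrow> prp Q \<Longrightarrow> prp (\<lambda>x. P x \<or> Q x)"
  using prp_not[OF prp_conj[OF prp_not[of P] prp_not[of Q]]] by simp

lemma prp_le: "pr f \<Longrightarrow> pr g \<Longrightarrow> prp (\<lambda>x. f x \<le> g x)"
  using prp_zero[OF pr_diff[of f g]] by simp

lemma prp_less: "pr f \<Longrightarrow> pr g \<Longrightarrow> prp (\<lambda>x. f x < g x)"
  using prp_not[OF prp_le[of g f]] by (simp add: not_le)

lemma prp_eq: "pr f \<Longrightarrow> pr g \<Longrightarrow> prp (\<lambda>x. f x = g x)"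
  using prp_conj[OF prp_le[of f g] prp_le[of g f]] by (simp add: eq_iff)

lemma prp_bex:
  assumes "pr k" "prp (\<lambda>z. P (pfst z) (psnd z))"
  shows "prp (\<lambda>x. \<exists>i<k x. P x i)"
proof -
  have "rec_nat 0 (\<lambda>i r. if P x i then 1 else r) m = (if \<exists>i<m. P x i then 1 else (0::nat))" for x and m :: nat
    by (induction m) (auto simp: less_Suc_eq)
  moreover have "pr (\<lambda>x. rec_nat 0 (\<lambda>i r. if P x i then 1 else r) (k x))"
  proof (intro pr_basic pr_if assms(1))
    have "pr (\<lambda>z. if P (pfst (pair (pfst z) (pfst (psnd z)))) (psnd (pair (pfst z) (pfst (psnd z)))) then 1 else 0)"
      by (rule pr_comp[of "\<lambda>z. if P (pfst z) (psnd z) then 1 else 0"]) (use assms(2) in \<open>auto simp: prp_def intro!: pr_basic\<close>)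
    then show "prp (\<lambda>z. P (pfst z) (pfst (psnd z)))" by (simp add: prp_def)
  qed
  ultimately show ?thesis unfolding prp_def by (simp only:)
qed

lemma prp_ball:
  assumes "pr k" "prp (\<lambda>z. P (pfst z) (psnd z))"
  shows "prp (\<lambda>x. \<forall>i<k x. P x i)"
  using prp_not[OF prp_bex[OF assms(1) prp_not[OF assms(2)]]] by simp

lemma prp_comp: "prp P \<Longrightarrow> pr f \<Longrightarrow> prp (\<lambda>x. P (f x))"
  unfolding prp_def by (rule pr_comp)

lemma pr_sum:
  assumes "pr k" "pr (\<lambda>z. G (pfst z) (psnd z))"
  shows "pr (\<lambda>x. \<Sum>i<k x. G x i)"
proof -
  have "rec_nat 0 (\<lambda>i r. r + G x i) m = (\<Sum>i<m. G x i)" for x and m :: nat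
    by (induction m) auto
  moreover have "pr (\<lambda>x. rec_nat 0 (\<lambda>i r. r + G x i) (k x))"
  proof (intro pr_basic pr_add assms(1))
    have "pr (\<lambda>z. G (pfst (pair (pfst z) (pfst (psnd z)))) (psnd (pair (pfst z) (pfst (psnd z)))))"
      by (rule pr_comp[of "\<lambda>z. G (pfst z) (psnd z)"]) (auto intro!: pr_basic assms)
    then show "pr (\<lambda>z. G (pfst z) (pfst (psnd z)))" by simp
  qed
  ultimately show ?thesis by simp
qed

lemmas pr_rules = pr_basic pr_add pr_diff pr_mult pr_power pr_mod2 pr_div2 pr_if pr_sum
  prp_const prp_not prp_conj prp_disj prp_le prp_less prp_eq prp_bex prp_ball

section \<open>A decider with a fast path\<close>

text \<open>Bijective base 2 with the first bit least significant; the digits 1 and 2 are the tape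
  symbols of the bits. Unlike ordinary binary it is a bijection onto the naturals, and prepending a
  bit is plain arithmetic. The index \<open>str_to_nat x\<close> is the code of the reversed
  string.\<close>

fun bcode :: "bool list \<Rightarrow> nat" where
  "bcode [] = 0"
| "bcode (b # x) = 2 * bcode x + (if b then 2 else 1)"

text \<open>Successive queries differ by one appended zero, so the machine keeps its query tape and
  spends constant time per query. Queries of different strings of equal length never coincide, which
  makes their events independent.\<close>

definition fast :: "(nat \<Rightarrow> bool) \<Rightarrow> bool list \<Rightarrow> bool" where
  "fast A x \<longleftrightarrow> (\<forall>j \<le> length x div 2. A (str_to_nat (x @ replicate j False)))"

definition input :: "bool list \<Rightarrow> nat \<Rightarrow> nat" where
  "input x i = (if i < length x then bit_sym (x ! i) else 0)"

definition Init :: com where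
  "Init = Act (\<lambda>ss i. if i < 2 then (ss ! i, 0) else (1, if i = 2 then 1 else 0))"

text \<open>The heads of tapes 2 and 3 move along without changing a cell, so both counters grow by
  the length of the input.\<close>

definition Copy_input :: com where
  "Copy_input = While (\<lambda>ss. ss ! 0 \<noteq> 0)
     (Act (\<lambda>ss i. (if i = 1 then ss ! 0 else ss ! i, if i < 4 then 1 else 0)))"

text \<open>Counter 2 starts at \<open>length x + 1\<close> and is decremented twice per query, so that there are
\<open>length x div 2 + 1\<close> queries; counter 4 counts the negative answers.\<close>

definition Query :: com where
  "Query = Loop 2 (Seq (Ask 4) (Seq
     (Act (\<lambda>ss i. (if i = 1 then 1 else ss ! i, if i = 1 then 1 else if i = 2 then - 1 else 0))) (Dec 2)))"

definition Double :: com where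
  "Double = Seq (Loop 5 (Seq (Dec 5) (Seq (Inc 6) (Inc 7)))) (Seq (Move 6 5) (Move 7 5))"

text \<open>Horner's rule for \<open>bcode\<close>, from the last bit back to the first. The input
  tape has no left end marker, so counter 3 tells how many cells remain.\<close>

definition Read_input :: com where
  "Read_input = Loop 3 (Seq (Act (move (\<lambda>i. if i = 0 \<or> i = 3 then - 1 else 0)))
     (Seq Double (Seq (Inc 5) (Act (\<lambda>ss i. (ss ! i, if i = 5 \<and> ss ! 0 = 2 then 1 else 0))))))"

text \<open>The loop is a conditional: its body clears counter 4 and hence runs at most once, and
  only after a negative answer. If it is skipped, counter 5 still has the value 0 and scans the
  symbol 1, which means rejection.\<close>

definition Slow :: "com \<Rightarrow> com" where
  "Slow c = Loop 4 (Seq Read_input (Seq c (Clear 4)))"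

definition Decide :: "com \<Rightarrow> com" where
  "Decide c = Seq Init (Seq Copy_input (Seq Query (Slow c)))"

text \<open>Before the \<open>Ask\<close> come one state of \<open>Init\<close>, three of
  \<open>Copy_input\<close> and the test of the loop in \<open>Query\<close>.\<close>

lemma asks_Decide: "(\<And>p. asks p c = {}) \<Longrightarrow> asks 0 (Decide c) = {5}"
  by (simp add: Decide_def Init_def Copy_input_def Query_def Slow_def Read_input_def Double_def)

lemma clen_Decide: "5 < clen (Decide c)"
  by (simp add: Decide_def Init_def Copy_input_def Query_def)

definition copied :: "bool list \<Rightarrow> nat \<Rightarrow> nat \<Rightarrow> tape" where
  "copied x k = counters
     (\<lambda>i. if i = 0 then (input x, k) else (\<lambda>j. if j < k then input x j else 0, k))
     (\<lambda>i. if i = 2 then Suc k else if i = 3 then k else 0)"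

definition queried :: "bool list \<Rightarrow> nat \<Rightarrow> nat \<Rightarrow> nat \<Rightarrow> nat \<Rightarrow> tape" where
  "queried x j c q = counters
     (\<lambda>i. if i = 0 then (input x, length x)
       else (\<lambda>i. if i < length x then input x i else if i < length x + j then 1 else 0, length x + j))
     (\<lambda>i. if i = 2 then c else if i = 3 then length x else if i = 4 then q else 0)"

lemma input_eq_0: "input x i = 0 \<longleftrightarrow> length x \<le> i"
  by (simp add: input_def bit_sym_def)

lemma input_le: "input x i \<le> 2"
  by (simp add: input_def bit_sym_def)

lemma exec_ActI: "perform n f T = T' \<Longrightarrow> exec n A (Act f) T 1 T'"
  using exec.Act[of n A f T] by simp

lemma exec_Loop:
  "syms n T ! r \<noteq> 1 \<Longrightarrow> exec n A c T t T' \<Longrightarrow> exec n A (Loop r c) T' u T'' \<Longrightarrow> exec n A (Loop r c) T (t + u + 2) T''"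
  by (rule exec.While_True)

lemma exec_Loop_end: "syms n T ! r = 1 \<Longrightarrow> exec n A (Loop r c) T 1 T"
  by (rule exec.While_False) simp

text \<open>Tapes from \<open>n\<close> on lie outside the machine, but \<open>counters\<close> puts
  a \<open>marker\<close> on all of them and \<open>Init\<close> cannot write there; so they carry
  it from the beginning.\<close>

definition start :: "nat \<Rightarrow> bool list \<Rightarrow> nat \<Rightarrow> tape" where
  "start n x i = (if i = 0 then (input x, 0) else if i < n then (\<lambda>_. 0, 0) else (marker, 0))"

lemma start_init: "ntapes M = n \<Longrightarrow> 2 \<le> n \<Longrightarrow> map (start n x) [0..<n] = snd (init_config M x)"
  by (rule nth_equalityI) (auto simp: init_config_def start_def nth_Cons' input_def)

lemma exec_Init:
  assumes "4 < n"
  shows "exec n A Init (start n x) 1 (copied x 0)"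
proof -
  have "perform n (\<lambda>ss i. if i < 2 then (ss ! i, 0) else (1, if i = 2 then 1 else 0)) (start n x) = copied x 0"
    using assms by (intro ext) (auto simp: perform_def sanitize_def syms_nth apply_act_def start_def
      copied_def counters_def marker_def split: prod.splits)
  then show ?thesis unfolding Init_def by (rule exec_ActI)
qed

lemma exec_Copy_input:
  assumes "4 < n"
  shows "exec n A Copy_input (copied x 0) (3 * length x + 1) (copied x (length x))"
proof -
  have "exec n A Copy_input (copied x k) (3 * d + 1) (copied x (length x))" if "k + d = length x" for k d
    using that
  proof (induction d arbitrary: k)
    case 0
    then have "syms n (copied x k) ! 0 = 0"
      using assms by (simp add: syms_nth copied_def counters_def input_eq_0)
    then have "exec n A Copy_input (copied x k) 1 (copied x k)"
      unfolding Copy_input_def by (intro exec.While_False) simp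
    with 0 show ?case by simp
  next
    case (Suc d)
    have "perform n (\<lambda>ss i. (if i = 1 then ss ! 0 else ss ! i, if i < 4 then 1 else 0)) (copied x k) = copied x (Suc k)"
      using assms by (intro ext) (auto simp: perform_def sanitize_def syms_nth apply_act_def input_le
        copied_def counters_def marker_def fun_eq_iff less_Suc_eq nat_add_distrib)
    then have 1: "exec n A (Act (\<lambda>ss i. (if i = 1 then ss ! 0 else ss ! i, if i < 4 then 1 else 0)))
        (copied x k) 1 (copied x (Suc k))"
      by (rule exec_ActI)
    have "syms n (copied x k) ! 0 \<noteq> 0"
      using assms Suc.prems by (simp add: syms_nth copied_def counters_def input_eq_0)
    then have "exec n A Copy_input (copied x k) (1 + (3 * d + 1) + 2) (copied x (length x))"
      using Suc.IH[of "Suc k"] Suc.prems 1 unfolding Copy_input_def by (intro exec.While_True) auto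
    then show ?case by (simp add: eval_nat_numeral)
  qed
  then show ?thesis by simp
qed

lemma copied_queried: "copied x (length x) = queried x 0 (Suc (length x)) 0"
  by (rule ext) (auto simp: copied_def queried_def counters_def fun_eq_iff input_def)

lemma query_word_queried:
  assumes "2 \<le> n"
  shows "query_word (map (queried x j c q) [0..<n]) = x @ replicate j False"
proof -
  let ?c = "\<lambda>i. if i < length x then input x i else if i < length x + j then 1 else 0"
  have c: "?c i \<notin> {1, 2} \<longleftrightarrow> length x + j \<le> i" for i
    by (auto simp: input_def bit_sym_def)
  have "fst (map (queried x j c q) [0..<n] ! 1) = ?c"
    using assms by (auto simp: queried_def counters_def fun_eq_iff)
  moreover have "(LEAST i. ?c i \<notin> {1, 2}) = length x + j"
    unfolding c by (rule Least_equality) auto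
  ultimately have "query_word (map (queried x j c q) [0..<n]) = map (\<lambda>i. ?c i = 2) [0..<length x + j]"
    unfolding query_word_def Let_def by (simp only:)
  also have "\<dots> = x @ replicate j False"
    by (rule nth_equalityI) (auto simp: nth_append input_def bit_sym_def)
  finally show ?thesis .
qed

lemma ball_interval_Suc:
  "j \<le> l \<Longrightarrow> (\<forall>i::nat. j \<le> i \<and> i \<le> l \<longrightarrow> P i) \<longleftrightarrow> P j \<and> (\<forall>i. Suc j \<le> i \<and> i \<le> l \<longrightarrow> P i)"
  by (metis Suc_leD Suc_leI le_neq_implies_less order_refl)

lemma exec_Query:
  assumes "4 < n"
  shows "\<exists>t q. t \<le> 5 * length x + 20 \<and> exec n A Query (copied x (length x)) t (queried x (length x div 2 + 1) 0 q)
    \<and> (q = 0 \<longleftrightarrow> fast A x)"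
proof -
  let ?l = "length x"
  \<comment> \<open>Truncated subtraction: for even length the last round finds the value 1 in
    counter 2, and its second decrement stays at 0.\<close>
  let ?S = "\<lambda>j q. queried x j (Suc ?l - 2 * j) q"
  have body: "\<exists>q'. exec n A (Seq (Ask 4) (Seq
     (Act (\<lambda>ss i. (if i = 1 then 1 else ss ! i, if i = 1 then 1 else if i = 2 then - 1 else 0))) (Dec 2)))
     (?S j q) 5 (?S (Suc j) q') \<and> (q' = 0 \<longleftrightarrow> q = 0 \<and> A (str_to_nat (x @ replicate j False)))" for j q
  proof -
    have ask: "\<exists>q'. exec n A (Ask 4) (?S j q) 3 (?S j q') \<and> (q' = 0 \<longleftrightarrow> q = 0 \<and> A (str_to_nat (x @ replicate j False)))"
    proof (cases "A (str_to_nat (x @ replicate j False))")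
      case True
      then have "exec n A (Ask 4) (?S j q) 3 (?S j q)"
        using assms by (intro exec.Ask_yes) (simp add: query_word_queried)
      with True show ?thesis by blast
    next
      case False
      then have "exec n A (Ask 4) (?S j q) 3 (perform n (right 4) (?S j q))"
        using assms by (intro exec.Ask_no) (simp add: query_word_queried)
      moreover have "perform n (right 4) (?S j q) = ?S j (Suc q)"
        using assms unfolding queried_def
        by (subst perform_right_counters) (auto intro!: arg_cong[where f = "counters _"])
      ultimately show ?thesis using False by (metis nat.distinct(1))
    qed
    have "perform n (\<lambda>ss i. (if i = 1 then 1 else ss ! i, if i = 1 then 1 else if i = 2 then - 1 else 0)) (?S j q')
      = queried x (Suc j) (Suc ?l - 2 * j - 1) q'" for q'
      using assms by (intro ext) (auto simp: perform_def sanitize_def syms_nth apply_act_def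
        queried_def counters_def marker_def fun_eq_iff less_Suc_eq nat_add_distrib nat_diff_distrib)
    then have 1: "exec n A (Act (\<lambda>ss i. (if i = 1 then 1 else ss ! i, if i = 1 then 1 else if i = 2 then - 1 else 0)))
       (?S j q') 1 (queried x (Suc j) (Suc ?l - 2 * j - 1) q')" for q'
      by (rule exec_ActI)
    have "perform n (left 2) (queried x (Suc j) (Suc ?l - 2 * j - 1) q') = ?S (Suc j) q'" for q'
      using assms unfolding queried_def
      by (subst perform_left_counters) (auto intro!: arg_cong[where f = "counters _"])
    then have 2: "exec n A (Dec 2) (queried x (Suc j) (Suc ?l - 2 * j - 1) q') 1 (?S (Suc j) q')" for q'
      by (rule exec_ActI)
    from ask obtain q' where q': "exec n A (Ask 4) (?S j q) 3 (?S j q')"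
      "q' = 0 \<longleftrightarrow> q = 0 \<and> A (str_to_nat (x @ replicate j False))" by blast
    have "exec n A (Seq (Ask 4) (Seq
     (Act (\<lambda>ss i. (if i = 1 then 1 else ss ! i, if i = 1 then 1 else if i = 2 then - 1 else 0))) (Dec 2)))
     (?S j q) (3 + (1 + 1)) (?S (Suc j) q')"
      by (rule exec.Seq[OF q'(1) exec.Seq[OF 1 2]])
    with q'(2) show ?thesis by auto
  qed
  have "\<exists>q'. exec n A Query (?S j q) (7 * d + 1) (?S (?l div 2 + 1) q') \<and>
     (q' = 0 \<longleftrightarrow> q = 0 \<and> (\<forall>i. j \<le> i \<and> i \<le> ?l div 2 \<longrightarrow> A (str_to_nat (x @ replicate i False))))"
    if "j + d = ?l div 2 + 1" for j d q
    using that
  proof (induction d arbitrary: j q)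
    case 0
    then have j: "j = ?l div 2 + 1" by simp
    have "Suc ?l - 2 * j = 0" using j by linarith
    then have "syms n (?S j q) ! 2 = 1"
      using assms by (simp add: queried_def syms_counters marker_def)
    then have "exec n A Query (?S j q) 1 (?S j q)"
      unfolding Query_def by (intro exec_Loop_end)
    with j show ?case by auto
  next
    case (Suc d)
    have "Suc ?l - 2 * j \<noteq> 0" using Suc.prems by linarith
    then have 0: "syms n (?S j q) ! 2 \<noteq> 1"
      using assms by (simp add: queried_def syms_counters marker_def)
    obtain q1 where q1: "exec n A (Seq (Ask 4) (Seq
     (Act (\<lambda>ss i. (if i = 1 then 1 else ss ! i, if i = 1 then 1 else if i = 2 then - 1 else 0))) (Dec 2)))
     (?S j q) 5 (?S (Suc j) q1)" "q1 = 0 \<longleftrightarrow> q = 0 \<and> A (str_to_nat (x @ replicate j False))"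
      using body by blast
    obtain q2 where q2: "exec n A Query (?S (Suc j) q1) (7 * d + 1) (?S (?l div 2 + 1) q2)"
      "q2 = 0 \<longleftrightarrow> q1 = 0 \<and> (\<forall>i. Suc j \<le> i \<and> i \<le> ?l div 2 \<longrightarrow> A (str_to_nat (x @ replicate i False)))"
      using Suc.IH[of "Suc j" q1] Suc.prems by auto
    have "exec n A Query (?S j q) (5 + (7 * d + 1) + 2) (?S (?l div 2 + 1) q2)"
      using exec_Loop[OF 0 q1(1) q2(1)[unfolded Query_def]] unfolding Query_def .
    moreover have "q2 = 0 \<longleftrightarrow> q = 0 \<and> (\<forall>i. j \<le> i \<and> i \<le> ?l div 2 \<longrightarrow> A (str_to_nat (x @ replicate i False)))"
      unfolding q2(2) q1(2) using ball_interval_Suc[of j "?l div 2"] Suc.prems by simp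
    moreover have "5 + (7 * d + 1) + 2 = 7 * Suc d + 1" by simp
    ultimately show ?case by metis
  qed
  from this[of 0 "?l div 2 + 1" 0] obtain q where q: "exec n A Query (?S 0 0) (7 * (?l div 2 + 1) + 1) (?S (?l div 2 + 1) q)"
    "q = 0 \<longleftrightarrow> fast A x" by (auto simp: fast_def)
  have "Suc ?l - 2 * (?l div 2 + 1) = 0" by presburger
  with q have "exec n A Query (copied x ?l) (7 * (?l div 2 + 1) + 1) (queried x (?l div 2 + 1) 0 q)"
    by (simp add: copied_queried)
  moreover have "7 * (?l div 2 + 1) + 1 \<le> 5 * ?l + 20"
  proof -
    have "7 * (d + 1) + 1 \<le> 5 * m + 20" if "d * 2 \<le> m" for d m :: nat using that by presburger
    then show ?thesis using div_times_less_eq_dividend[of ?l 2] by blast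
  qed
  ultimately show ?thesis using q(2) by blast
qed

lemma computes_Double:
  assumes "7 < n" "s 6 = 0" "s 7 = 0" "s' = s(5 := 2 * s 5)"
  shows "computes n Double s s'"
  unfolding Double_def
proof (intro computes_Seq)
  show "computes n (Loop 5 (Seq (Dec 5) (Seq (Inc 6) (Inc 7)))) s (s(5 := 0, 6 := s 5, 7 := s 5))"
    by (rule computes_Loop[where S = "\<lambda>k. s(5 := k, 6 := s 5 - k, 7 := s 5 - k)" and m = "s 5", OF _ computes_Dec_Inc_Inc])
       (use assms in \<open>auto simp: fun_eq_iff\<close>)
  show "computes n (Move 6 5) (s(5 := 0, 6 := s 5, 7 := s 5)) (s(5 := s 5, 6 := 0, 7 := s 5))"
    by (rule computes_Move) (use assms in \<open>auto simp: fun_eq_iff\<close>)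
  show "computes n (Move 7 5) (s(5 := s 5, 6 := 0, 7 := s 5)) s'"
    by (rule computes_Move) (use assms in \<open>auto simp: fun_eq_iff\<close>)
qed

lemma exec_Read_input:
  assumes "7 < n" "T 0 = (input x, length x)" "s 3 = length x" "\<forall>i>4. s i = 0"
  shows "\<exists>t. exec n A Read_input (counters T s) t (counters (T(0 := (input x, 0))) (s(3 := 0, 5 := bcode x)))"
proof -
  let ?T = "\<lambda>k v. counters (T(0 := (input x, k))) (s(3 := k, 5 := v))"
  have "\<exists>t. exec n A Read_input (?T k (bcode (drop k x))) t (?T 0 (bcode x))" if "k \<le> length x" for k
    using that
  proof (induction k)
    case 0
    have "exec n A Read_input (?T 0 (bcode x)) 1 (?T 0 (bcode x))"
      unfolding Read_input_def using assms by (intro exec_Loop_end) (simp add: syms_counters marker_def)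
    then show ?case unfolding drop_0 by blast
  next
    case (Suc k)
    let ?v = "bcode (drop (Suc k) x)"
    have 0: "syms n (?T (Suc k) ?v) ! 3 \<noteq> 1"
      using assms by (simp add: syms_counters marker_def)
    have "perform n (move (\<lambda>i. if i = 0 \<or> i = 3 then - 1 else 0)) (?T (Suc k) ?v) = ?T k ?v"
      using assms by (intro ext) (auto simp: perform_def sanitize_def syms_nth apply_act_def move_def
        counters_def marker_def fun_eq_iff nat_diff_distrib case_prod_beta)
    then have 1: "exec n A (Act (move (\<lambda>i. if i = 0 \<or> i = 3 then - 1 else 0))) (?T (Suc k) ?v) 1 (?T k ?v)"
      by (rule exec_ActI)
    have "computes n Double (s(3 := k, 5 := ?v)) (s(3 := k, 5 := 2 * ?v))"
      by (rule computes_Double) (use assms in auto)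
    then obtain t2 where 2: "exec n A Double (?T k ?v) t2 (?T k (2 * ?v))"
      unfolding computes_def by blast
    have "computes n (Inc 5) (s(3 := k, 5 := 2 * ?v)) (s(3 := k, 5 := Suc (2 * ?v)))"
      by (rule computes_Inc) (use assms in auto)
    then obtain t3 where 3: "exec n A (Inc 5) (?T k (2 * ?v)) t3 (?T k (Suc (2 * ?v)))"
      unfolding computes_def by blast
    have drop: "drop k x = x ! k # drop (Suc k) x"
      using Suc.prems by (simp add: Cons_nth_drop_Suc)
    have "perform n (\<lambda>ss i. (ss ! i, if i = 5 \<and> ss ! 0 = 2 then 1 else 0)) (?T k (Suc (2 * ?v)))
       = ?T k (bcode (drop k x))"
      using assms Suc.prems unfolding drop
      by (intro ext) (auto simp: perform_def sanitize_def syms_nth apply_act_def input_def bit_sym_def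
        counters_def marker_def fun_eq_iff nat_add_distrib case_prod_beta)
    then have 4: "exec n A (Act (\<lambda>ss i. (ss ! i, if i = 5 \<and> ss ! 0 = 2 then 1 else 0))) (?T k (Suc (2 * ?v))) 1
       (?T k (bcode (drop k x)))"
      by (rule exec_ActI)
    obtain t5 where 5: "exec n A Read_input (?T k (bcode (drop k x))) t5 (?T 0 (bcode x))"
      using Suc.IH[OF Suc_leD[OF Suc.prems]] by (elim exE)
    from exec_Loop[OF 0 exec.Seq[OF 1 exec.Seq[OF 2 exec.Seq[OF 3 4]]] 5[unfolded Read_input_def]]
    show ?case unfolding Read_input_def by (intro exI)
  qed
  from this[OF order_refl] show ?thesis
  proof -
    have eq: "?T (length x) (bcode (drop (length x) x)) = counters T s"
      using assms by (auto simp: counters_def fun_eq_iff)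
    assume "\<exists>t. exec n A Read_input (?T (length x) (bcode (drop (length x) x))) t (?T 0 (bcode x))"
    then show ?thesis unfolding eq .
  qed
qed

text \<open>The machine does not depend on the oracle. It rejects fast strings without looking at
  \<open>\<phi>\<close>, so it decides the language of \<open>\<phi>\<close> only relative to
  oracles that make no string of that language fast.\<close>

theorem prp_decider:
  assumes "prp \<phi>"
  shows "\<exists>M. wf_tm M \<and> (\<forall>A x.
     (fast A x \<longrightarrow> (\<exists>t \<le> 20 * length x + 40. fst (run M A x t) = q_reject M)) \<and>
     (\<not> fast A x \<longrightarrow> (\<exists>t. fst (run M A x t) = (if \<phi> (bcode x) then q_accept M else q_reject M))))"
proof -
  let ?f = "\<lambda>x. if \<phi> x then 1 else 0 :: nat"
  from assms obtain P d where P: "\<And>b p. asks p (P b) = {}"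
    "\<And>n b s s'. 2 \<le> b \<Longrightarrow> b + d < n \<Longrightarrow> \<forall>i>b. s i = 0 \<Longrightarrow> s' = s(b := ?f (s b)) \<Longrightarrow> computes n (P b) s s'"
    unfolding prp_def by (rule prE) blast
  \<comment> \<open>Tapes 5 to \<open>5 + d\<close> hold the argument and the scratch space of
    \<open>P 5\<close>; \<open>Double\<close> needs tapes 6 and 7.\<close>
  define n where "n = d + 10"
  have n: "7 < n" "5 + d < n" by (auto simp: n_def)
  let ?c = "Decide (P 5)"
  let ?M = "machine n ?c 5 5"
  have 1: "\<exists>t q. t \<le> 8 * length x + 22 \<and> (q = 0 \<longleftrightarrow> fast A x) \<and>
     (\<forall>u T. exec n A (Slow (P 5)) (queried x (length x div 2 + 1) 0 q) u T \<longrightarrow> exec n A ?c (start n x) (t + u) T)" for A x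
  proof -
    obtain t q where tq: "t \<le> 5 * length x + 20"
      "exec n A Query (copied x (length x)) t (queried x (length x div 2 + 1) 0 q)" "q = 0 \<longleftrightarrow> fast A x"
      using exec_Query[of n x A] n by auto
    have "exec n A ?c (start n x) (1 + (3 * length x + 1 + (t + u))) T"
      if "exec n A (Slow (P 5)) (queried x (length x div 2 + 1) 0 q) u T" for u T
      unfolding Decide_def
      by (rule exec.Seq[OF exec_Init exec.Seq[OF exec_Copy_input exec.Seq[OF tq(2) that]]]) (use n in auto)
    then have "\<forall>u T. exec n A (Slow (P 5)) (queried x (length x div 2 + 1) 0 q) u T \<longrightarrow>
        exec n A ?c (start n x) ((3 * length x + 2 + t) + u) T"
      by (simp add: ac_simps)
    moreover have "3 * length x + 2 + t \<le> 8 * length x + 22" using tq(1) by simp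
    ultimately show ?thesis using tq(3) by (intro exI[of _ "3 * length x + 2 + t"] exI[of _ q] conjI)
  qed
  have run: "fst (run ?M A x (Suc t)) = (if fst (T 5) (snd (T 5)) \<noteq> 1 then q_accept ?M else q_reject ?M)"
    if "exec n A ?c (start n x) t T" for A x t T
  proof (rule machine_run[OF that])
    show "asks 0 ?c \<subseteq> {5}" using asks_Decide[OF P(1)] by simp
    show "map (start n x) [0..<n] = snd (init_config ?M x)"
      by (rule start_init) (use n in \<open>auto simp: machine_def\<close>)
  qed (use n in auto)
  show ?thesis
  proof (intro exI[of _ ?M] conjI allI impI)
    show "wf_tm ?M" using n by (intro wf_machine clen_Decide) auto
    fix A x
    obtain t q where t: "t \<le> 8 * length x + 22" and q: "q = 0 \<longleftrightarrow> fast A x"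
      and "\<forall>u T. exec n A (Slow (P 5)) (queried x (length x div 2 + 1) 0 q) u T \<longrightarrow> exec n A ?c (start n x) (t + u) T"
      using 1[of x A] by (elim exE conjE)
    note ex = this(3)[rule_format]
    let ?s = "\<lambda>i::nat. if i = 2 then 0 else if i = 3 then length x else if i = 4 then q else 0"
    obtain T where Q: "queried x (length x div 2 + 1) 0 q = counters T ?s" and T: "T 0 = (input x, length x)"
      unfolding queried_def by simp
    show "\<exists>t\<le>20 * length x + 40. fst (run ?M A x t) = q_reject ?M" if "fast A x"
    proof -
      have "syms n (counters T ?s) ! 4 = 1"
        using q that n by (simp add: syms_counters marker_def)
      then have "exec n A (Slow (P 5)) (counters T ?s) 1 (counters T ?s)"
        unfolding Slow_def by (intro exec_Loop_end)
      from run[OF ex[unfolded Q, OF this]] have "fst (run ?M A x (Suc (t + 1))) = q_reject ?M"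
        by (simp add: counters_def marker_def)
      with t show ?thesis by (intro exI[of _ "Suc (t + 1)"]) auto
    qed
    show "\<exists>t. fst (run ?M A x t) = (if \<phi> (bcode x) then q_accept ?M else q_reject ?M)" if "\<not> fast A x"
    proof -
      let ?T = "T(0 := (input x, 0))"
      have 0: "syms n (counters T ?s) ! 4 \<noteq> 1"
        using q that n by (simp add: syms_counters marker_def)
      obtain t1 where t1: "exec n A Read_input (counters T ?s) t1 (counters ?T (?s(3 := 0, 5 := bcode x)))"
        using exec_Read_input[where T = T and s = ?s and x = x and n = n and A = A] n T by auto
      have "computes n (P 5) (?s(3 := 0, 5 := bcode x)) (?s(3 := 0, 5 := ?f (bcode x)))"
        by (rule P(2)) (use n in auto)
      then obtain t2 where t2: "exec n A (P 5) (counters ?T (?s(3 := 0, 5 := bcode x))) t2 (counters ?T (?s(3 := 0, 5 := ?f (bcode x))))"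
        unfolding computes_def by blast
      have "computes n (Clear 4) (?s(3 := 0, 5 := ?f (bcode x))) (?s(3 := 0, 5 := ?f (bcode x), 4 := 0))"
        by (rule computes_Clear) (use n in auto)
      then obtain t3 where t3: "exec n A (Clear 4) (counters ?T (?s(3 := 0, 5 := ?f (bcode x)))) t3
          (counters ?T (?s(3 := 0, 5 := ?f (bcode x), 4 := 0)))"
        unfolding computes_def by blast
      let ?U = "counters ?T (?s(3 := 0, 5 := ?f (bcode x), 4 := 0))"
      have "syms n ?U ! 4 = 1"
        using n by (simp add: syms_counters marker_def)
      then have "exec n A (Slow (P 5)) ?U 1 ?U"
        unfolding Slow_def by (rule exec_Loop_end)
      then have "exec n A (Slow (P 5)) (counters T ?s) (t1 + (t2 + t3) + 1 + 2) ?U"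
        unfolding Slow_def by (rule exec_Loop[OF 0 exec.Seq[OF t1 exec.Seq[OF t2 t3]]])
      show ?thesis
        by (rule exI, rule trans[OF run[OF ex[unfolded Q, OF \<open>exec n A (Slow (P 5)) (counters T ?s) _ ?U\<close>]]])
           (simp add: counters_def marker_def)
    qed
  qed
qed

section \<open>Simulation of oracle-free machines\<close>

definition ctl :: "nat \<Rightarrow> nat" where "ctl v = (v - 1) div 2"

text \<open>Reads off the digit 1 or 2 of bijective base 2, and 0 past the end; this is the symbol
  in cell \<open>i\<close> of the input tape, the blank included.\<close>

definition cnth :: "nat \<Rightarrow> nat \<Rightarrow> nat" where
  "cnth v i = (let w = (ctl ^^ i) v in if w = 0 then 0 else 1 + (w - 1) mod 2)"

definition clength :: "nat \<Rightarrow> nat" where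
  "clength v = (\<Sum>i<v. if cnth v i = 0 then 0 else 1)"

lemma ctl_bcode: "ctl (bcode x) = bcode (tl x)"
  by (cases x) (auto simp: ctl_def)

lemma ctl_funpow_bcode: "(ctl ^^ i) (bcode x) = bcode (drop i x)"
  by (induction i) (simp_all add: ctl_bcode tl_drop drop_Suc)

lemma cnth_bcode: "cnth (bcode x) i = input x i"
proof (cases "i < length x")
  case True
  then have "drop i x = x ! i # drop (Suc i) x" by (simp add: Cons_nth_drop_Suc)
  then show ?thesis using True
    by (simp add: cnth_def ctl_funpow_bcode input_def bit_sym_def del: drop_Suc)
next
  case False
  then show ?thesis by (simp add: cnth_def ctl_funpow_bcode input_def)
qed

lemma length_le_bcode: "length x \<le> bcode x"
  by (induction x) auto

lemma clength_bcode: "clength (bcode x) = length x"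
proof -
  have "(\<Sum>i<bcode x. if cnth (bcode x) i = 0 then 0 else 1) = (\<Sum>i | i < bcode x \<and> i < length x. 1::nat)"
    by (rule sum.mono_neutral_cong_right) (auto simp: cnth_bcode input_eq_0)
  also have "{i. i < bcode x \<and> i < length x} = {..<length x}"
    using length_le_bcode[of x] by auto
  finally show ?thesis by (simp add: clength_def)
qed

lemma pr_ctl: "pr f \<Longrightarrow> pr (\<lambda>x. ctl (f x))"
  unfolding ctl_def by (intro pr_rules)

lemma pr_cnth: "pr f \<Longrightarrow> pr g \<Longrightarrow> pr (\<lambda>x. cnth (f x) (g x))"
  unfolding cnth_def Let_def by (intro pr_rules pr_ctl)

lemma pr_clength: assumes "pr f" shows "pr (\<lambda>x. clength (f x))"
  unfolding clength_def by (intro assms pr_rules pr_cnth pr_comp[OF assms])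

text \<open>A finite function on the naturals is coded as an association list.\<close>

definition skip :: "nat \<Rightarrow> nat \<Rightarrow> nat" where
  "skip k s = (if s = 0 \<or> pfst (pfst (s - 1)) = k then s else psnd (s - 1))"

text \<open>The code of the list is itself the number of rounds: every effective \<open>skip\<close>
  lowers the code, so \<open>s\<close> rounds reach an entry for \<open>k\<close> or the empty list.
  The default 0 is at once the blank and the initial head position, so the empty list already
  represents blank tapes.\<close>

definition get :: "nat \<Rightarrow> nat \<Rightarrow> nat" where
  "get s k = (let t = (skip k ^^ s) s in if t = 0 then 0 else psnd (pfst (t - 1)))"

definition put :: "nat \<Rightarrow> nat \<Rightarrow> nat \<Rightarrow> nat" where
  "put k v s = Suc (pair (pair k v) s)"

lemma skip_stable: "s \<le> n \<Longrightarrow> (skip k ^^ n) s = (skip k ^^ s) s"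
proof (induction s arbitrary: n rule: less_induct)
  case (less s)
  show ?case
  proof (cases "skip k s = s")
    case True
    then have "(skip k ^^ m) s = s" for m by (induction m) auto
    then show ?thesis by simp
  next
    case False
    then have s: "s \<noteq> 0" and eq: "skip k s = psnd (s - 1)"
      by (auto simp: skip_def split: if_splits)
    have "psnd (s - 1) \<le> s - 1"
      using le_prod_encode_2[of "psnd (s - 1)" "pfst (s - 1)"] by simp
    with s have lt: "skip k s < s" unfolding eq by linarith
    obtain n' where n': "n = Suc n'" using less.prems s by (cases n) auto
    obtain s' where s': "s = Suc s'" using s by (cases s) auto
    have "(skip k ^^ n) s = (skip k ^^ n') (skip k s)" by (simp add: n' funpow_swap1)
    also have "\<dots> = (skip k ^^ s') (skip k s)"
      using less.IH[OF lt, of n'] less.IH[OF lt, of s'] lt less.prems n' s' by simp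
    also have "\<dots> = (skip k ^^ s) s" by (simp add: s' funpow_swap1)
    finally show ?thesis .
  qed
qed

lemma get_0: "get 0 k = 0"
  by (simp add: get_def)

lemma get_put: "get (put k v s) k' = (if k = k' then v else get s k')"
proof (cases "k = k'")
  case True
  then have "skip k' (put k v s) = put k v s" by (simp add: skip_def put_def)
  then have "(skip k' ^^ n) (put k v s) = put k v s" for n by (induction n) auto
  then show ?thesis using True by (simp add: get_def) (simp add: put_def)
next
  case False
  then have sk: "skip k' (put k v s) = s" by (simp add: skip_def put_def)
  have "s \<le> pair (pair k v) s" by (rule le_prod_encode_2)
  then have "(skip k' ^^ put k v s) (put k v s) = (skip k' ^^ s) s"
    using skip_stable[of s "pair (pair k v) s" k'] sk by (simp add: put_def funpow_swap1)
  then show ?thesis using False by (simp add: get_def)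
qed

lemma finite_function_code:
  assumes "finite K"
  shows "\<exists>e. \<forall>k\<in>K. get e k = F k"
  using assms
proof (induction K)
  case (insert k K)
  then obtain e where "\<forall>k\<in>K. get e k = F k" by blast
  then show ?case by (intro exI[of _ "put k (F k) e"]) (auto simp: get_put)
qed simp

lemma pr_get:
  assumes f: "pr f" and g: "pr g"
  shows "pr (\<lambda>x. get (f x) (g x))"
  unfolding get_def skip_def Let_def
  by (intro f g pr_rules pr_comp[OF f] pr_comp[OF g])

lemma pr_put: "pr f \<Longrightarrow> pr g \<Longrightarrow> pr h \<Longrightarrow> pr (\<lambda>x. put (f x) (g x) (h x))"
  unfolding put_def by (intro pr_rules)

text \<open>A tape store \<open>s\<close> has the head position of tape \<open>i\<close> at key \<open>pair i 0\<close> and the content of its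
cell \<open>j\<close> at key \<open>pair i (Suc j)\<close>. A machine code \<open>e\<close> has the parameters of the machine at the keys
\<open>pair 0 j\<close> and its transition table at the keys \<open>pair (Suc q) (pair c j)\<close>, where \<open>c\<close> codes the
scanned symbols; \<open>j = 0\<close> gives the next state and \<open>j = Suc i\<close> the action on tape \<open>i\<close>.\<close>

definition scan :: "(nat \<Rightarrow> nat) \<Rightarrow> nat \<Rightarrow> nat" where
  "scan f n = rec_nat 0 (\<lambda>i r. Suc (pair (f i) r)) n"

definition scanned :: "nat \<Rightarrow> nat \<Rightarrow> nat" where
  "scanned s i = get s (pair i (Suc (get s (pair i 0))))"

definition table :: "nat \<Rightarrow> nat \<Rightarrow> nat \<Rightarrow> nat \<Rightarrow> nat" where
  "table e q c j = get e (pair (Suc q) (pair c j))"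

text \<open>The table stores moves increased by one, and \<open>- 1\<close> undoes the shift; being
  truncated, it keeps a head at cell 0 just as \<open>apply_act\<close> does. Old values are read
  from \<open>s\<close>, while \<open>r\<close> collects the changes.\<close>

definition update :: "nat \<Rightarrow> nat \<Rightarrow> nat \<Rightarrow> nat \<Rightarrow> nat \<Rightarrow> nat" where
  "update s e q c n = rec_nat s (\<lambda>i r.
     put (pair i 0) (get s (pair i 0) + psnd (table e q c (Suc i)) - 1)
       (put (pair i (Suc (get s (pair i 0)))) (pfst (table e q c (Suc i))) r)) n"

definition sim_step :: "nat \<Rightarrow> nat \<Rightarrow> nat" where
  "sim_step e z = pair (table e (pfst z) (scan (scanned (psnd z)) (get e (pair 0 0))) 0)
     (update (psnd z) e (pfst z) (scan (scanned (psnd z)) (get e (pair 0 0))) (get e (pair 0 0)))"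

definition sim_init :: "nat \<Rightarrow> nat" where
  "sim_init v = rec_nat 0 (\<lambda>i r. put (pair 0 (Suc i)) (cnth v i) r) v"

definition sim_state :: "nat \<Rightarrow> nat \<Rightarrow> nat \<Rightarrow> nat" where
  "sim_state e v t = pfst ((sim_step e ^^ t) (pair (get e (pair 0 1)) (sim_init v)))"

lemma pr_scan:
  assumes "pr n" "pr (\<lambda>z. f (pfst z) (psnd z))"
  shows "pr (\<lambda>x. scan (f x) (n x))"
  unfolding scan_def
proof (intro pr_rules assms(1))
  have "pr (\<lambda>z. f (pfst (pair (pfst z) (pfst (psnd z)))) (psnd (pair (pfst z) (pfst (psnd z)))))"
    by (rule pr_comp[of "\<lambda>z. f (pfst z) (psnd z)"]) (intro pr_rules assms)+
  then show "pr (\<lambda>z. f (pfst z) (pfst (psnd z)))" by simp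
qed

lemma pr_sim_state:
  assumes e: "pr e" and v: "pr v" and t: "pr t"
  shows "pr (\<lambda>x. sim_state (e x) (v x) (t x))"
  unfolding sim_state_def sim_step_def update_def table_def scanned_def sim_init_def
  by (intro assms pr_rules pr_scan pr_get pr_put pr_cnth pr_comp[OF e] pr_comp[OF v])

lemma scan_cong: "(\<And>i. i < n \<Longrightarrow> f i = g i) \<Longrightarrow> scan f n = scan g n"
  unfolding scan_def by (induction n) auto

lemma scan_inj: "scan f n = scan g n \<Longrightarrow> i < n \<Longrightarrow> f i = g i"
  unfolding scan_def by (induction n) (auto simp: less_Suc_eq)

text \<open>Without an oracle every query is answered no, so halting and querying become ordinary
  transitions that rewrite the scanned symbols and stay. The simulator then needs nothing but a
  table.\<close>

definition next_action :: "tm \<Rightarrow> nat \<Rightarrow> nat list \<Rightarrow> nat \<times> (nat \<times> int) list" where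
  "next_action M q ss =
     (if q = q_accept M \<or> q = q_reject M then (q, map (\<lambda>s. (s, 0)) ss)
      else if q = q_query M then (q_no M, map (\<lambda>s. (s, 0)) ss) else delta M q ss)"

definition codes_tm :: "nat \<Rightarrow> tm \<Rightarrow> bool" where
  "codes_tm e M \<longleftrightarrow> get e (pair 0 0) = ntapes M \<and> get e (pair 0 1) = q_start M \<and>
     get e (pair 0 2) = q_accept M \<and> get e (pair 0 3) = q_reject M \<and>
     (\<forall>q ss. q < nstates M \<and> length ss = ntapes M \<and> set ss \<subseteq> {..<nsyms M} \<longrightarrow>
       table e q (scan (nth ss) (ntapes M)) 0 = fst (next_action M q ss) \<and>
       (\<forall>i < ntapes M. table e q (scan (nth ss) (ntapes M)) (Suc i)
          = pair (fst (snd (next_action M q ss) ! i)) (nat (snd (snd (next_action M q ss) ! i) + 1))))"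

text \<open>\<open>codes_tm\<close> prescribes entries only for states below
  \<open>nstates M\<close> and symbols below \<open>nsyms M\<close>. These are finitely many, so the
  arbitrary function \<open>delta M\<close> enters through a single number.\<close>

lemma ex_codes_tm: "\<exists>e. codes_tm e M"
proof -
  let ?n = "ntapes M"
  let ?S = "{ss. set ss \<subseteq> {..<nsyms M} \<and> length ss = ?n}"
  define word where "word c = (SOME ss. length ss = ?n \<and> scan (nth ss) ?n = c)" for c
  have word: "word (scan (nth ss) ?n) = ss" if "length ss = ?n" for ss
  proof -
    have "length (word (scan (nth ss) ?n)) = ?n \<and> scan (nth (word (scan (nth ss) ?n))) ?n = scan (nth ss) ?n"
      unfolding word_def by (rule someI[of _ ss]) (use that in simp)
    then show ?thesis using that by (intro nth_equalityI) (auto dest: scan_inj)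
  qed
  define param where "param j = (if j = 0 then ?n else if j = 1 then q_start M else if j = 2 then q_accept M else q_reject M)" for j :: nat
  define tab where "tab q c j = (let a = next_action M q (word c) in
     if j = 0 then fst a else pair (fst (snd a ! (j - 1))) (nat (snd (snd a ! (j - 1)) + 1)))" for q c j
  define F where "F k = (if pfst k = 0 then param (psnd k) else tab (pfst k - 1) (pfst (psnd k)) (psnd (psnd k)))" for k
  define K where "K = pair 0 ` {..3} \<union>
     (\<lambda>(q, ss, j). pair (Suc q) (pair (scan (nth ss) ?n) j)) ` ({..<nstates M} \<times> ?S \<times> {..?n})"
  have "finite ?S" by (rule finite_lists_length_eq) simp
  then have "finite K" unfolding K_def by auto
  then obtain e where e: "\<forall>k\<in>K. get e k = F k" using finite_function_code by blast
  have "get e (pair 0 j) = param j" if "j \<le> 3" for j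
    using e[rule_format, of "pair 0 j"] that by (auto simp: K_def F_def)
  moreover have "table e q (scan (nth ss) ?n) j = tab q (scan (nth ss) ?n) j"
    if "q < nstates M" "ss \<in> ?S" "j \<le> ?n" for q ss j
  proof -
    have "(q, ss, j) \<in> {..<nstates M} \<times> ?S \<times> {..?n}" using that by auto
    then have "(\<lambda>(q, ss, j). pair (Suc q) (pair (scan (nth ss) ?n) j)) (q, ss, j) \<in> K"
      unfolding K_def by (intro UnI2 imageI)
    then show ?thesis using e by (simp add: table_def F_def)
  qed
  ultimately have "codes_tm e M"
    unfolding codes_tm_def by (auto simp: param_def tab_def word Let_def)
  then show ?thesis by blast
qed

text \<open>Keeps the state and the scanned symbols within the range for which
  \<open>codes_tm\<close> prescribes the table.\<close>

definition good_config :: "tm \<Rightarrow> config \<Rightarrow> bool" where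
  "good_config M cf \<longleftrightarrow> fst cf < nstates M \<and> length (snd cf) = ntapes M \<and>
     (\<forall>i < ntapes M. \<forall>j. fst (snd cf ! i) j < nsyms M)"

definition represents :: "tm \<Rightarrow> nat \<Rightarrow> config \<Rightarrow> bool" where
  "represents M z cf \<longleftrightarrow> pfst z = fst cf \<and> (\<forall>i < ntapes M.
     get (psnd z) (pair i 0) = snd (snd cf ! i) \<and> (\<forall>j. get (psnd z) (pair i (Suc j)) = fst (snd cf ! i) j))"

lemma step_next_action:
  "length ts = length (read_syms ts) \<Longrightarrow>
   step M no_oracle (q, ts) = (case next_action M q (read_syms ts) of (q', as) \<Rightarrow> (q', map2 apply_act ts as))"
proof -
  have "map2 apply_act ts (map (\<lambda>s. (s, 0)) (read_syms ts)) = ts"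
    by (rule nth_equalityI) (auto simp: read_syms_def apply_act_def split: prod.splits)
  then show ?thesis by (simp add: step_def next_action_def)
qed

lemma next_action_wf:
  assumes "wf_tm M" "q < nstates M" "length ss = ntapes M" "set ss \<subseteq> {..<nsyms M}" "next_action M q ss = (q', as)"
  shows "q' < nstates M \<and> length as = ntapes M \<and>
     (\<forall>i < ntapes M. fst (as ! i) < nsyms M \<and> snd (as ! i) \<in> {-1, 0, 1})"
proof (cases "q \<in> {q_accept M, q_reject M, q_query M}")
  case True
  have nth: "ss ! i < nsyms M" if "i < ntapes M" for i
    using that assms(3,4) by (metis lessThan_iff nth_mem subsetD)
  show ?thesis using True assms nth by (auto simp: next_action_def wf_tm_def split: if_splits)
next
  case False
  then have "delta M q ss = (q', as)" using assms(5) by (auto simp: next_action_def)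
  moreover have "\<forall>s\<in>set ss. s < nsyms M" using assms(4) by auto
  ultimately have "q' < nstates M \<and> length as = ntapes M \<and> (\<forall>(s, m) \<in> set as. s < nsyms M \<and> m \<in> {-1, 0, 1})"
    using assms(1-3) unfolding wf_tm_def by fastforce
  then show ?thesis by (metis (no_types, lifting) case_prod_beta nth_mem)
qed

lemma get_update:
  "get (update s e q c n) (pair i 0) =
     (if i < n then get s (pair i 0) + psnd (table e q c (Suc i)) - 1 else get s (pair i 0))"
  "get (update s e q c n) (pair i (Suc j)) =
     (if i < n \<and> j = get s (pair i 0) then pfst (table e q c (Suc i)) else get s (pair i (Suc j)))"
  unfolding update_def by (induction n) (auto simp: get_put less_Suc_eq)

lemma sim_step_correct:
  assumes "wf_tm M" "codes_tm e M" "good_config M cf" "represents M z cf"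
  shows "good_config M (step M no_oracle cf) \<and> represents M (sim_step e z) (step M no_oracle cf)"
proof -
  obtain q ts where cf: "cf = (q, ts)" by force
  let ?n = "ntapes M" and ?ss = "read_syms ts"
  obtain q' as where na: "next_action M q ?ss = (q', as)" by force
  have len: "length ts = ?n" "length ?ss = ?n" and q: "q < nstates M"
    and good: "\<And>i j. i < ?n \<Longrightarrow> fst (ts ! i) j < nsyms M"
    using assms(3) by (auto simp: good_config_def cf read_syms_def)
  have ss_nth: "?ss ! i = fst (ts ! i) (snd (ts ! i))" if "i < ?n" for i
    using that len by (simp add: read_syms_def case_prod_beta)
  have ss: "set ?ss \<subseteq> {..<nsyms M}"
    using good len by (auto simp: in_set_conv_nth ss_nth)
  have step: "step M no_oracle cf = (q', map2 apply_act ts as)"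
    using step_next_action[of ts M q] na len by (simp add: cf)
  note wf = next_action_wf[OF assms(1) q len(2) ss na]
  have nth: "map2 apply_act ts as ! i
     = ((fst (ts ! i))(snd (ts ! i) := fst (as ! i)), nat (int (snd (ts ! i)) + snd (as ! i)))" if "i < ?n" for i
    using that len wf by (simp add: apply_act_def case_prod_beta)
  have "good_config M (step M no_oracle cf)"
    unfolding step good_config_def using wf len nth good by auto
  moreover have "represents M (sim_step e z) (step M no_oracle cf)"
  proof -
    have pz: "pfst z = q" and rep: "\<And>i. i < ?n \<Longrightarrow> get (psnd z) (pair i 0) = snd (ts ! i)"
      "\<And>i j. i < ?n \<Longrightarrow> get (psnd z) (pair i (Suc j)) = fst (ts ! i) j"
      using assms(4) by (auto simp: represents_def cf)
    have sc: "scan (scanned (psnd z)) ?n = scan (nth ?ss) ?n"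
      by (rule scan_cong) (simp add: scanned_def rep ss_nth)
    have nt: "get e (pair 0 0) = ?n" using assms(2) by (simp add: codes_tm_def)
    have tab: "table e q (scan (nth ?ss) ?n) 0 = q'"
      "\<And>i. i < ?n \<Longrightarrow> table e q (scan (nth ?ss) ?n) (Suc i) = pair (fst (as ! i)) (nat (snd (as ! i) + 1))"
      using assms(2) q len(2) ss na by (auto simp: codes_tm_def)
    have move: "snd (ts ! i) + nat (snd (as ! i) + 1) - 1 = nat (int (snd (ts ! i)) + snd (as ! i))" if "i < ?n" for i
    proof -
      have "snd (as ! i) = -1 \<or> snd (as ! i) = 0 \<or> snd (as ! i) = 1" using wf that by auto
      then show ?thesis by (elim disjE) (simp_all add: nat_add_distrib nat_diff_distrib)
    qed
    show ?thesis
      unfolding represents_def sim_step_def step nt pz sc tab(1)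
      by (auto simp: get_update rep nth tab(2) move[unfolded One_nat_def])
  qed
  ultimately show ?thesis by blast
qed

lemma get_sim_init: "get (sim_init v) (pair i 0) = 0" "get (sim_init v) (pair i (Suc j)) = (if i = 0 \<and> j < v then cnth v j else 0)"
proof -
  have "get (rec_nat 0 (\<lambda>i r. put (pair 0 (Suc i)) (cnth v i) r) n) (pair i 0) = 0 \<and>
    get (rec_nat 0 (\<lambda>i r. put (pair 0 (Suc i)) (cnth v i) r) n) (pair i (Suc j)) = (if i = 0 \<and> j < n then cnth v j else 0)" for n
    by (induction n) (auto simp: get_put get_0)
  then show "get (sim_init v) (pair i 0) = 0" "get (sim_init v) (pair i (Suc j)) = (if i = 0 \<and> j < v then cnth v j else 0)"
    by (auto simp: sim_init_def)
qed

theorem sim_state_run: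
  assumes "wf_tm M" "codes_tm e M"
  shows "sim_state e (bcode x) t = fst (run M no_oracle x t)"
proof -
  let ?z = "pair (get e (pair 0 1)) (sim_init (bcode x))"
  have nt: "2 \<le> ntapes M" "3 \<le> nsyms M" using assms(1) by (auto simp: wf_tm_def)
  have init: "snd (init_config M x) ! i = (if i = 0 then (input x, 0) else (\<lambda>_. 0, 0))" if "i < ntapes M" for i
    using that nt by (auto simp: init_config_def nth_Cons' input_def)
  have "cnth (bcode x) j = 0" if "\<not> j < bcode x" for j
    using that length_le_bcode[of x] by (simp add: cnth_bcode input_eq_0)
  then have cell: "(if i = 0 \<and> j < bcode x then cnth (bcode x) j else 0) = (if i = 0 then input x j else 0)" for i j
    using cnth_bcode[of x j] by auto
  have "q_start M < nstates M" using assms(1) by (simp add: wf_tm_def)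
  then have good: "good_config M (init_config M x)"
    using init nt input_le[of x] unfolding good_config_def
    by (auto simp: init_config_def le_less_trans[OF _ less_le_trans[of 2 3]])
  have "represents M ?z (init_config M x)"
    using init assms(2) unfolding represents_def
    by (auto simp: get_sim_init cell codes_tm_def init_config_def[of M x])
  then have "good_config M (run M no_oracle x t) \<and>
     represents M ((sim_step e ^^ t) ?z) (run M no_oracle x t)"
  proof (induction t)
    case 0
    with good show ?case by (simp add: run_def)
  next
    case (Suc t)
    have "good_config M (step M no_oracle (run M no_oracle x t)) \<and>
        represents M (sim_step e ((sim_step e ^^ t) ?z)) (step M no_oracle (run M no_oracle x t))"
      using Suc by (intro sim_step_correct assms) auto
    then show ?case by (simp add: run_def)
  qed
  then show ?thesis by (simp add: sim_state_def represents_def)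
qed

section \<open>Schnorr tests from local events\<close>

text \<open>Every string asks at least one query, so with the empty oracle no string is fast and the
  decider always takes the slow path.\<close>

lemma computable_lang_prp: "prp \<phi> \<Longrightarrow> computable_lang {x. \<phi> (bcode x)}"
proof -
  assume "prp \<phi>"
  from prp_decider[OF this] obtain M where "wf_tm M"
    and M: "\<And>A x. \<not> fast A x \<Longrightarrow> \<exists>t. fst (run M A x t) = (if \<phi> (bcode x) then q_accept M else q_reject M)"
    by blast
  have nf: "\<not> fast no_oracle x" for x by (auto simp: fast_def)
  have "q_accept M \<noteq> q_reject M" using \<open>wf_tm M\<close> by (auto simp: wf_tm_def)
  then have "\<exists>t. fst (run M no_oracle x t) \<in> {q_accept M, q_reject M} \<and>
      (fst (run M no_oracle x t) = q_accept M \<longleftrightarrow> x \<in> {x. \<phi> (bcode x)})" for x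
  proof -
    obtain t where "fst (run M no_oracle x t) = (if \<phi> (bcode x) then q_accept M else q_reject M)"
      using M[OF nf] by blast
    then show ?thesis using \<open>q_accept M \<noteq> q_reject M\<close> by (intro exI[of _ t]) simp
  qed
  then show ?thesis unfolding computable_lang_def decides_def using \<open>wf_tm M\<close> by blast
qed

lemma bcode_inj: "bcode x = bcode y \<longleftrightarrow> x = y"
proof (induction x arbitrary: y)
  case Nil
  show ?case by (cases y) auto
next
  case (Cons b x)
  show ?case
  proof (cases y)
    case (Cons c z)
    have "2 * bcode x + 2 \<noteq> 2 * bcode z + 1" "2 * bcode x + 1 \<noteq> 2 * bcode z + 2" by presburger+
    then show ?thesis using Cons.IH[of z] \<open>y = c # z\<close> by (cases b; cases c) auto
  qed simp
qed

lemma bcode_surj: "\<exists>x. bcode x = v"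
proof (induction v rule: less_induct)
  case (less v)
  show ?case
  proof (cases "v = 0")
    case True
    then show ?thesis by (intro exI[of _ "[]"]) simp
  next
    case False
    then have "(v - 1) div 2 < v" by linarith
    then obtain x where x: "bcode x = (v - 1) div 2" using less by blast
    have "bcode (even v # x) = v" using False by (auto simp: x)
    then show ?thesis by blast
  qed
qed

lemma bcode_le: "bcode x + 2 \<le> 2 ^ Suc (length x)"
  by (induction x) auto

definition cat :: "nat \<Rightarrow> nat \<Rightarrow> nat" where
  "cat k v = ((\<lambda>w. 2 * w + 2) ^^ k) (2 * v + 1)"

lemma bcode_enc_nat: "bcode (enc_nat k @ x) = cat k (bcode x)"
  unfolding enc_nat_def cat_def by (induction k) auto

lemma pr_cat: "pr f \<Longrightarrow> pr g \<Longrightarrow> pr (\<lambda>x. cat (f x) (g x))"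
  unfolding cat_def by (intro pr_rules)

lemma prp_binary:
  assumes "prp (\<lambda>z. Q (pfst z) (psnd z))" "pr f" "pr g"
  shows "prp (\<lambda>x. Q (f x) (g x))"
proof -
  have "prp (\<lambda>x. Q (pfst (pair (f x) (g x))) (psnd (pair (f x) (g x))))"
    by (rule prp_comp[OF assms(1)]) (intro pr_rules assms)
  then show ?thesis by simp
qed

lemma enc_nat_append: "enc_nat k @ x = enc_nat l @ y \<longleftrightarrow> k = l \<and> x = y"
proof (induction k arbitrary: l)
  case 0
  show ?case by (cases l) (auto simp: enc_nat_def)
next
  case (Suc k)
  show ?case by (cases l) (use Suc in \<open>auto simp: enc_nat_def\<close>)
qed

lemma bcode_enc_nat_bounds: "k < bcode (enc_nat k @ x)" "bcode x < bcode (enc_nat k @ x)"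
proof -
  show "k < bcode (enc_nat k @ x)"
    using length_le_bcode[of "enc_nat k @ x"] by (simp add: enc_nat_def)
  show "bcode x < bcode (enc_nat k @ x)"
    unfolding enc_nat_def by (induction k) auto
qed

section \<open>Measure of events fixed by finitely many bits\<close>

interpretation coin: prob_space coin_space
  unfolding coin_space_def by (intro prob_space_PiM prob_space_measure_pmf)

lemma measure_fixed_bits:
  assumes "finite J"
  shows "{A. \<forall>i\<in>J. A i = v i} \<in> sets coin_space"
    and "measure coin_space {A. \<forall>i\<in>J. A i = v i} = 1 / 2 ^ card J"
proof -
  let ?M = "\<lambda>_::nat. measure_pmf (bernoulli_pmf (1/2))"
  interpret product_prob_space ?M UNIV
    by unfold_locales
  have eq: "{A. \<forall>i\<in>J. A i = v i} = prod_emb UNIV ?M J (Pi\<^sub>E J (\<lambda>i. {v i}))"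
    by (auto simp: prod_emb_def PiE_def Pi_def)
  show "{A. \<forall>i\<in>J. A i = v i} \<in> sets coin_space"
    unfolding eq coin_space_def using assms by (intro sets_PiM_I) auto
  have "measure (Pi\<^sub>M UNIV ?M) (prod_emb UNIV ?M J (Pi\<^sub>E J (\<lambda>i. {v i}))) = (\<Prod>i\<in>J. measure (?M i) {v i})"
    by (rule measure_PiM_emb) (use assms in auto)
  also have "\<dots> = (\<Prod>i\<in>J. 1 / 2)"
    by (intro prod.cong refl) (simp add: measure_pmf_single pmf_bernoulli_half)
  finally show "measure coin_space {A. \<forall>i\<in>J. A i = v i} = 1 / 2 ^ card J"
    by (simp add: eq coin_space_def power_one_over)
qed

lemma measure_prefix:
  "{A. map A [0..<n] \<in> S} \<in> sets coin_space"
  "measure coin_space {A. map A [0..<n] \<in> S} = card {s \<in> S. length s = n} / 2 ^ n"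
proof -
  let ?S = "{s \<in> S. length s = n}"
  let ?B = "\<lambda>s. {A. map A [0..<n] = s}"
  have fin: "finite ?S"
    by (rule finite_subset[OF _ finite_lists_length_eq[of "UNIV :: bool set" n]]) auto
  have B: "?B s = {A. \<forall>i\<in>{..<n}. A i = s ! i}" if "s \<in> ?S" for s
    using that by (auto simp: list_eq_iff_nth_eq)
  have eq: "{A. map A [0..<n] \<in> S} = (\<Union>s\<in>?S. ?B s)" by auto
  have sets: "?B s \<in> sets coin_space" if "s \<in> ?S" for s
    unfolding B[OF that] by (rule measure_fixed_bits) simp
  have meas: "measure coin_space (?B s) = 1 / 2 ^ n" if "s \<in> ?S" for s
    unfolding B[OF that] by (subst measure_fixed_bits) auto
  show "{A. map A [0..<n] \<in> S} \<in> sets coin_space"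
    unfolding eq using fin sets by (intro sets.finite_UN) auto
  have "measure coin_space (\<Union>s\<in>?S. ?B s) = (\<Sum>s\<in>?S. measure coin_space (?B s))"
    by (rule coin.finite_measure_finite_Union[OF fin]) (use sets in \<open>auto simp: disjoint_family_on_def\<close>)
  also have "\<dots> = (\<Sum>s\<in>?S. 1 / 2 ^ n)" by (intro sum.cong refl meas)
  finally show "measure coin_space {A. map A [0..<n] \<in> S} = card ?S / 2 ^ n"
    unfolding eq by simp
qed

text \<open>Turns the counting of strings into a bounded sum over codes, which is primitive
  recursive.\<close>

lemma card_bcode: "card {s. length s = n \<and> P (bcode s)} = (\<Sum>v<2 ^ Suc n. if clength v = n \<and> P v then 1 else 0)"
proof -
  have "bcode ` {s. length s = n \<and> P (bcode s)} = {v \<in> {..<2 ^ Suc n}. clength v = n \<and> P v}"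
  proof (intro equalityI subsetI)
    fix v assume v: "v \<in> {v \<in> {..<2 ^ Suc n}. clength v = n \<and> P v}"
    obtain s where "bcode s = v" using bcode_surj by blast
    with v show "v \<in> bcode ` {s. length s = n \<and> P (bcode s)}" by (auto simp: clength_bcode)
  next
    fix v assume "v \<in> bcode ` {s. length s = n \<and> P (bcode s)}"
    then obtain s where "v = bcode s" "length s = n" "P (bcode s)" by blast
    then show "v \<in> {v \<in> {..<2 ^ Suc n}. clength v = n \<and> P v}"
      using bcode_le[of s] by (simp add: clength_bcode)
  qed
  moreover have "inj_on bcode {s. length s = n \<and> P (bcode s)}" by (rule inj_onI) (simp add: bcode_inj)
  ultimately have "card {s. length s = n \<and> P (bcode s)} = card {v \<in> {..<2 ^ Suc n}. clength v = n \<and> P v}"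
    using card_image by fastforce
  also have "\<dots> = (\<Sum>v<2 ^ Suc n. if clength v = n \<and> P v then 1 else 0)"
    by (subst sum.inter_filter[symmetric]) simp_all
  finally show ?thesis .
qed

text \<open>An effective Borel-Cantelli setting. \<open>Q\<close> has to work on every prefix of
  length at least \<open>g m\<close>, so that several events can be read off one common
  prefix.\<close>

locale local_events =
  fixes E :: "nat \<Rightarrow> (nat \<Rightarrow> bool) set" and g :: "nat \<Rightarrow> nat" and Q :: "nat \<Rightarrow> nat \<Rightarrow> bool"
  assumes pr_g: "pr g" and prp_Q: "prp (\<lambda>z. Q (pfst z) (psnd z))"
    and event: "\<And>m n A. g m \<le> n \<Longrightarrow> A \<in> E m \<longleftrightarrow> Q m (bcode (map A [0..<n]))"
    and small: "\<And>m. measure coin_space (E m) \<le> 1 / 2 ^ m"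
begin

definition V :: "nat \<Rightarrow> nat \<Rightarrow> (nat \<Rightarrow> bool) set" where "V n k = (\<Union>m\<in>{n<..k}. E m)"

definition U :: "nat \<Rightarrow> (nat \<Rightarrow> bool) set" where "U n = (\<Union>m\<in>{n<..}. E m)"

text \<open>A common prefix length for the events up to \<open>k\<close>. Any computable upper bound
  of these \<open>g m\<close> would do; a sum is easier to compute than a maximum.\<close>

definition G :: "nat \<Rightarrow> nat" where "G k = (\<Sum>m<Suc k. g m)"

definition count :: "nat \<Rightarrow> nat \<Rightarrow> nat" where
  "count n k = (\<Sum>v<2 ^ Suc (G k). if clength v = G k \<and> (\<exists>m<Suc k. n < m \<and> Q m v) then 1 else 0)"

lemma sets_E: "E m \<in> sets coin_space"
proof -
  have "E m = {A. map A [0..<g m] \<in> {s. Q m (bcode s)}}" using event[of m "g m"] by auto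
  then show ?thesis using measure_prefix(1)[of "g m" "{s. Q m (bcode s)}"] by (simp only:)
qed

lemma sets_V [simp]: "V n k \<in> sets coin_space"
  unfolding V_def by (intro sets.finite_UN) (auto intro: sets_E)

lemma sets_U [simp]: "U n \<in> sets coin_space"
  unfolding U_def by (intro sets.countable_UN) (auto intro: sets_E)

lemma measure_V: "measure coin_space (V n k) = count n k / 2 ^ G k"
proof -
  have "g m \<le> G k" if "m \<le> k" for m
    unfolding G_def using that by (intro member_le_sum) auto
  then have "V n k = {A. map A [0..<G k] \<in> {s. \<exists>m<Suc k. n < m \<and> Q m (bcode s)}}"
    unfolding V_def less_Suc_eq_le using event by (intro set_eqI) (simp, metis greaterThanAtMost_iff)
  moreover have "{s \<in> {s. \<exists>m<Suc k. n < m \<and> Q m (bcode s)}. length s = G k}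
     = {s. length s = G k \<and> (\<exists>m<Suc k. n < m \<and> Q m (bcode s))}" by auto
  ultimately show ?thesis
    by (simp only: measure_prefix(2) count_def card_bcode[where P = "\<lambda>v. \<exists>m<Suc k. n < m \<and> Q m v"])
qed

text \<open>Union bound for one further event at a time; the bracket is the exact partial sum of the
  geometric series, so the induction closes without loss.\<close>

lemma measure_V_le: "measure coin_space (V n (k + d)) \<le> measure coin_space (V n k) + (1 / 2 ^ k - 1 / 2 ^ (k + d))"
proof (induction d)
  case (Suc d)
  have "measure coin_space (V n (k + Suc d)) \<le> measure coin_space (V n (k + d) \<union> E (k + Suc d))"
    by (rule coin.finite_measure_mono) (auto simp: V_def sets_E[THEN sets.Un] le_Suc_eq intro!: sets.Un sets_E sets_V[unfolded V_def])
  also have "\<dots> \<le> measure coin_space (V n (k + d)) + measure coin_space (E (k + Suc d))"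
    by (rule measure_Un_le) (auto simp: sets_E)
  also have "\<dots> \<le> measure coin_space (V n (k + d)) + 1 / 2 ^ (k + Suc d)"
    using small[of "k + Suc d"] by simp
  moreover have "1 / 2 ^ (k + d) = 2 * (1 / 2 ^ (k + Suc d) :: real)" by simp
  ultimately show ?case using Suc by linarith
qed simp

text \<open>The events beyond \<open>k\<close> add up to at most 2^-k. So the finite unions
  \<open>V n k\<close>, whose measure is found by counting, approximate the tail at a known rate;
  this is what makes its measure computable.\<close>

lemma measure_U:
  "measure coin_space (V n k) \<le> measure coin_space (U n)"
  "measure coin_space (U n) \<le> measure coin_space (V n k) + 1 / 2 ^ k"
proof -
  show "measure coin_space (V n k) \<le> measure coin_space (U n)"
    by (rule coin.finite_measure_mono) (auto simp: V_def U_def intro: sets_U[unfolded U_def])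
  have "incseq (V n)" unfolding incseq_def V_def by (intro allI impI UN_mono) auto
  moreover have "(\<Union>j. V n j) = U n"
    unfolding V_def U_def by (auto, meson greaterThanAtMost_iff order_refl)
  ultimately have lim: "(\<lambda>j. measure coin_space (V n j)) \<longlonglongrightarrow> measure coin_space (U n)"
    using coin.finite_Lim_measure_incseq[of "V n"] by (simp add: image_subset_iff)
  have "measure coin_space (V n j) \<le> measure coin_space (V n k) + 1 / 2 ^ k" if "k \<le> j" for j
  proof -
    have "measure coin_space (V n j) \<le> measure coin_space (V n k) + (1 / 2 ^ k - 1 / 2 ^ j)"
      using measure_V_le[of n k "j - k"] that by simp
    also have "\<dots> \<le> measure coin_space (V n k) + 1 / 2 ^ k" by simp
    finally show ?thesis .
  qed
  then show "measure coin_space (U n) \<le> measure coin_space (V n k) + 1 / 2 ^ k"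
    by (intro LIMSEQ_le_const2[OF lim]) blast
qed

lemma measure_U_le: "measure coin_space (U n) \<le> 1 / 2 ^ n"
  \<comment> \<open>\<open>V n n\<close> is empty.\<close>
  using measure_U(2)[of n n] by (simp add: V_def)

lemma pr_G: "pr f \<Longrightarrow> pr (\<lambda>x. G (f x))"
  unfolding G_def by (intro pr_rules pr_comp[OF pr_g])

lemma pr_count:
  assumes "pr f" "pr h"
  shows "pr (\<lambda>x. count (f x) (h x))"
  unfolding count_def
  by (intro assms pr_rules pr_G pr_clength prp_binary[OF prp_Q] pr_comp[OF assms(1)] pr_comp[OF assms(2)])

text \<open>The witness \<open>k\<close> that \<open>ce_lang\<close> quantifies over is the index of
  the event. Demanding length at least \<open>g k\<close> ensures that \<open>Q k\<close> is
  evaluated only where it speaks about the event.\<close>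

lemma unif_sigma01_U: "unif_sigma01 U"
proof -
  define \<phi> where "\<phi> v = (\<exists>k<v. \<exists>n<v. \<exists>s<v. v = cat k (cat n s) \<and> n < k \<and> g k \<le> clength s \<and> Q k s)" for v
  have "prp \<phi>"
    unfolding \<phi>_def by (intro pr_rules pr_cat pr_clength pr_comp[OF pr_g] prp_binary[OF prp_Q])
  then have D: "computable_lang {x. \<phi> (bcode x)}" by (rule computable_lang_prp)
  have \<phi>: "\<phi> (bcode (enc_nat k @ enc_nat n @ s)) \<longleftrightarrow> n < k \<and> g k \<le> length s \<and> Q k (bcode s)" for k n s
  proof
    assume "\<phi> (bcode (enc_nat k @ enc_nat n @ s))"
    then obtain k' n' s' where *: "bcode (enc_nat k @ enc_nat n @ s) = cat k' (cat n' s')" "n' < k'"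
      "g k' \<le> clength s'" "Q k' s'" unfolding \<phi>_def by blast
    obtain t where t: "s' = bcode t" using bcode_surj by metis
    have "bcode (enc_nat k @ enc_nat n @ s) = bcode (enc_nat k' @ enc_nat n' @ t)"
      using *(1) by (simp add: t bcode_enc_nat)
    then have "k = k'" "n = n'" "s = t" by (auto simp: bcode_inj enc_nat_append)
    with * t show "n < k \<and> g k \<le> length s \<and> Q k (bcode s)" by (simp add: clength_bcode)
  next
    assume "n < k \<and> g k \<le> length s \<and> Q k (bcode s)"
    then show "\<phi> (bcode (enc_nat k @ enc_nat n @ s))"
      unfolding \<phi>_def using bcode_enc_nat_bounds[where k = k and x = "enc_nat n @ s"] bcode_enc_nat_bounds[where k = n and x = s]
      by (intro exI[of _ k] exI[of _ n] exI[of _ "bcode s"] conjI; simp add: bcode_enc_nat clength_bcode)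
  qed
  let ?W = "{w. \<exists>k. enc_nat k @ w \<in> {x. \<phi> (bcode x)}}"
  have W: "enc_nat n @ s \<in> ?W \<longleftrightarrow> (\<exists>k>n. g k \<le> length s \<and> Q k (bcode s))" for n s
    by (auto simp: \<phi>)
  have "U n = {A. \<exists>s. enc_nat n @ s \<in> ?W \<and> extends A s}" for n
  proof (intro equalityI subsetI)
    fix A assume "A \<in> U n"
    then obtain m where m: "n < m" "A \<in> E m" by (auto simp: U_def)
    then have "Q m (bcode (map A [0..<g m]))" using event[of m "g m" A] by simp
    then have "enc_nat n @ map A [0..<g m] \<in> ?W" using m unfolding W by (intro exI[of _ m]) simp
    moreover have "extends A (map A [0..<g m])" by (simp add: extends_def)
    ultimately show "A \<in> {A. \<exists>s. enc_nat n @ s \<in> ?W \<and> extends A s}" by blast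
  next
    fix A assume "A \<in> {A. \<exists>s. enc_nat n @ s \<in> ?W \<and> extends A s}"
    then obtain s k where s: "n < k" "g k \<le> length s" "Q k (bcode s)" "extends A s" unfolding W by blast
    have "map A [0..<length s] = s" using s(4) by (auto simp: extends_def intro: nth_equalityI)
    then have "A \<in> E k" using event[of k "length s" A] s by simp
    then show "A \<in> U n" using s(1) by (auto simp: U_def)
  qed
  moreover have "ce_lang ?W" unfolding ce_lang_def using D by blast
  ultimately show ?thesis unfolding unif_sigma01_def by blast
qed

text \<open>\<open>F n k\<close> is 2^k times the measure of \<open>V n k\<close>, rounded up. Both
  F n k / 2^k and the measure of \<open>U n\<close> lie between the measure of \<open>V n k\<close>
  and that value plus 2^-k, hence differ by at most 2^-k. The predicate \<open>ok\<close> states the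
  rounding in integers and has a unique solution, so the graph is decidable.\<close>

lemma unif_computable_U: "unif_computable_reals (\<lambda>n. measure coin_space (U n))"
proof -
  define ok where "ok n k f \<longleftrightarrow> count n k * 2 ^ k \<le> f * 2 ^ G k \<and> f * 2 ^ G k < count n k * 2 ^ k + 2 ^ G k" for n k f
  define F where "F n k = (LEAST f. count n k * 2 ^ k \<le> f * 2 ^ G k)" for n k
  have "ok n k (F n k)" for n k
  proof -
    have ex: "count n k * 2 ^ k \<le> (count n k * 2 ^ k) * 2 ^ G k" by simp
    have 1: "count n k * 2 ^ k \<le> F n k * 2 ^ G k"
      unfolding F_def by (rule LeastI[of "\<lambda>f. count n k * 2 ^ k \<le> f * 2 ^ G k", OF ex])
    show ?thesis
    proof (cases "F n k")
      case 0
      then show ?thesis using 1 by (simp add: ok_def)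
    next
      case (Suc f)
      then have "\<not> count n k * 2 ^ k \<le> f * 2 ^ G k"
        unfolding F_def by (intro not_less_Least) simp
      then show ?thesis using 1 Suc by (simp add: ok_def)
    qed
  qed
  moreover have "f = f'" if "ok n k f" "ok n k f'" for n k f f'
  proof -
    have "f * 2 ^ G k < Suc f' * 2 ^ G k" "f' * 2 ^ G k < Suc f * 2 ^ G k"
      using that by (auto simp: ok_def)
    then have "f < Suc f'" "f' < Suc f" by (simp_all only: mult_less_cancel2)
    then show ?thesis by simp
  qed
  ultimately have F: "ok n k f \<longleftrightarrow> f = F n k" for n k f by blast
  \<comment> \<open>\<open>2 * cat f 0 + 2\<close> is the code of \<open>enc_int (int f)\<close>:
    the sign bit \<open>True\<close> in front of the unary block.\<close>
  define \<phi> where "\<phi> v = (\<exists>n<v. \<exists>k<v. \<exists>f<v. v = cat n (cat k (2 * cat f 0 + 2)) \<and> ok n k f)" for v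
  have "prp \<phi>"
    unfolding \<phi>_def ok_def by (intro pr_rules pr_cat pr_G pr_count)
  then have D: "computable_lang {x. \<phi> (bcode x)}" by (rule computable_lang_prp)
  have code: "bcode (enc_nat n @ enc_nat k @ enc_int (int f)) = cat n (cat k (2 * cat f 0 + 2))" for n k f
    using bcode_enc_nat[of f "[]"] by (simp add: bcode_enc_nat enc_int_def)
  have "{x. \<phi> (bcode x)} = {enc_nat n @ enc_nat k @ enc_int (int (F n k)) | n k. True}"
  proof (intro equalityI subsetI)
    fix x assume "x \<in> {x. \<phi> (bcode x)}"
    then obtain n k f where "bcode x = cat n (cat k (2 * cat f 0 + 2))" "ok n k f"
      unfolding \<phi>_def by blast
    then have "x = enc_nat n @ enc_nat k @ enc_int (int (F n k))"
      unfolding code[symmetric] F by (simp add: bcode_inj)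
    then show "x \<in> {enc_nat n @ enc_nat k @ enc_int (int (F n k)) | n k. True}" by blast
  next
    fix x assume "x \<in> {enc_nat n @ enc_nat k @ enc_int (int (F n k)) | n k. True}"
    then obtain n k where x: "x = enc_nat n @ enc_nat k @ enc_int (int (F n k))" by blast
    have "F n k < bcode (enc_int (int (F n k)))"
      using bcode_enc_nat_bounds(1)[where k = "F n k" and x = "[]"] by (simp add: enc_int_def)
    then have "n < bcode x" "k < bcode x" "F n k < bcode x"
      using bcode_enc_nat_bounds[where k = n and x = "enc_nat k @ enc_int (int (F n k))"]
        bcode_enc_nat_bounds[where k = k and x = "enc_int (int (F n k))"] unfolding x by linarith+
    moreover have "bcode x = cat n (cat k (2 * cat (F n k) 0 + 2))" by (simp add: x code)
    moreover have "ok n k (F n k)" using F by blast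
    ultimately show "x \<in> {x. \<phi> (bcode x)}" unfolding \<phi>_def mem_Collect_eq by blast
  qed
  with D have "computable_lang {enc_nat n @ enc_nat k @ enc_int (int (F n k)) | n k. True}" by simp
  moreover have "\<bar>measure coin_space (U n) - real_of_int (int (F n k)) / 2 ^ k\<bar> \<le> 1 / 2 ^ k" for n k
  proof -
    have "ok n k (F n k)" using F by blast
    then have "real (count n k * 2 ^ k) \<le> real (F n k * 2 ^ G k)"
      "real (F n k * 2 ^ G k) < real (count n k * 2 ^ k + 2 ^ G k)"
      unfolding ok_def of_nat_le_iff of_nat_less_iff by auto
    then have "count n k / 2 ^ G k \<le> F n k / 2 ^ k" "F n k / 2 ^ k < count n k / 2 ^ G k + 1 / 2 ^ k"
      by (simp_all add: field_simps)
    then show ?thesis using measure_U[of n k] unfolding measure_V by (simp add: abs_le_iff)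
  qed
  ultimately show ?thesis
    unfolding unif_computable_reals_def by (intro exI[of _ "\<lambda>n k. int (F n k)"]) blast
qed

lemma schnorr_test_U: "schnorr_test U"
  unfolding schnorr_test_def using unif_sigma01_U unif_computable_U measure_U_le by blast

lemma schnorr_random_avoids: "schnorr_random A \<Longrightarrow> A \<notin> (\<Inter>n. U n)"
  using schnorr_test_U by (auto simp: schnorr_random_def)

lemma null_limsup: "(\<Inter>n. U n) \<in> null_sets coin_space"
proof -
  have sets: "(\<Inter>n. U n) \<in> sets coin_space" by (intro sets.countable_INT) auto
  have "measure coin_space (\<Inter>n. U n) \<le> 1 / 2 ^ n" for n
  proof -
    have "measure coin_space (\<Inter>n. U n) \<le> measure coin_space (U n)"
      by (rule coin.finite_measure_mono) auto
    then show ?thesis using measure_U_le[of n] by simp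
  qed
  moreover have "(\<lambda>n. 1 / 2 ^ n :: real) \<longlonglongrightarrow> 0"
    using LIMSEQ_power_zero[of "1 / 2 :: real"] by (simp add: power_one_over)
  ultimately have "measure coin_space (\<Inter>n. U n) \<le> 0"
    by (intro LIMSEQ_le_const[of _ 0]) auto
  then have "measure coin_space (\<Inter>n. U n) = 0" by (simp add: measure_le_0_iff)
  then show ?thesis using sets by (simp add: null_setsI coin.emeasure_eq_measure)
qed

end

section \<open>Diagonalization\<close>

lemma str_to_nat_snoc: "str_to_nat (x @ [b]) = 2 * str_to_nat x + (if b then 2 else 1)"
proof -
  obtain p where "(2::nat) ^ length x = Suc p" by (cases "(2::nat) ^ length x") auto
  then show ?thesis by (simp add: str_to_nat_def bin_val_def)
qed

lemma str_to_nat_rev: "str_to_nat (rev x) = bcode x"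
  by (induction x) (simp_all add: str_to_nat_snoc, simp add: str_to_nat_def bin_val_def)

lemma str_to_nat_bcode: "str_to_nat x = bcode (rev x)"
  using str_to_nat_rev[of "rev x"] by simp

lemma str_to_nat_inj: "str_to_nat x = str_to_nat y \<longleftrightarrow> x = y"
  by (simp add: str_to_nat_bcode bcode_inj)

text \<open>Horner's rule from the first bit on gives \<open>str_to_nat\<close>; each appended zero
  then sends an index \<open>w\<close> to \<open>2 * w + 1\<close>.\<close>

definition query_index :: "nat \<Rightarrow> nat \<Rightarrow> nat" where
  "query_index v j = ((\<lambda>w. 2 * w + 1) ^^ j) (rec_nat 0 (\<lambda>i r. 2 * r + cnth v i) (clength v))"

lemma query_index: "query_index (bcode x) j = str_to_nat (x @ replicate j False)"
proof -
  have "rec_nat 0 (\<lambda>i r. 2 * r + cnth (bcode x) i) k = str_to_nat (take k x)" if "k \<le> length x" for k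
    using that
  proof (induction k)
    case 0
    show ?case by (simp add: str_to_nat_def bin_val_def)
  next
    case (Suc k)
    then have "take (Suc k) x = take k x @ [x ! k]" by (simp add: take_Suc_conv_app_nth)
    with Suc show ?case by (simp add: str_to_nat_snoc cnth_bcode input_def bit_sym_def)
  qed
  then have x: "rec_nat 0 (\<lambda>i r. 2 * r + cnth (bcode x) i) (clength (bcode x)) = str_to_nat x"
    by (simp add: clength_bcode)
  have "((\<lambda>w. 2 * w + 1) ^^ j) (str_to_nat x) = str_to_nat (x @ replicate j False)"
  proof (induction j)
    case (Suc j)
    have "x @ replicate (Suc j) False = (x @ replicate j False) @ [False]"
      by (simp flip: replicate_append_same)
    then show ?case using Suc str_to_nat_snoc[of "x @ replicate j False" False] by simp
  qed simp
  then show ?thesis unfolding query_index_def x .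
qed

lemma pr_query_index:
  assumes f: "pr f" and h: "pr h"
  shows "pr (\<lambda>x. query_index (f x) (h x))"
  unfolding query_index_def by (intro f h pr_rules pr_cnth pr_clength pr_comp[OF f])

text \<open>Here \<open>s\<close> codes a prefix of the oracle, in which the symbol 2 stands for a
  member; positions past its end yield 0 and count as negative answers.\<close>

definition cfast :: "nat \<Rightarrow> nat \<Rightarrow> bool" where
  "cfast s v \<longleftrightarrow> (\<forall>j < Suc (clength v div 2). cnth s (query_index v j) = 2)"

lemma prp_cfast:
  assumes f: "pr f" and h: "pr h"
  shows "prp (\<lambda>x. cfast (f x) (h x))"
  unfolding cfast_def
  by (intro f h pr_rules pr_cnth pr_clength pr_query_index pr_comp[OF f] pr_comp[OF h])

text \<open>The longest query has \<open>2 * m + m\<close> bits, so its index lies below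
  \<open>2 ^ (3 * m + 1)\<close>.\<close>

lemma cfast_prefix:
  assumes "length x = 2 * m" "2 ^ (3 * m + 1) \<le> n"
  shows "cfast (bcode (map A [0..<n])) (bcode x) \<longleftrightarrow> fast A x"
proof -
  have "cnth (bcode (map A [0..<n])) (str_to_nat (x @ replicate j False)) = 2 \<longleftrightarrow>
      A (str_to_nat (x @ replicate j False))" if "j \<le> m" for j
  proof -
    have "str_to_nat (x @ replicate j False) + 2 \<le> 2 ^ Suc (length (rev (x @ replicate j False)))"
      unfolding str_to_nat_bcode by (rule bcode_le)
    also have "\<dots> \<le> 2 ^ (3 * m + 1)"
      using assms(1) that by (intro power_increasing) auto
    finally have "str_to_nat (x @ replicate j False) < n" using assms(2) by simp
    then show ?thesis by (simp add: cnth_bcode input_def bit_sym_def)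
  qed
  then show ?thesis
    unfolding cfast_def fast_def query_index clength_bcode less_Suc_eq_le using assms(1) by auto
qed

section \<open>Probabilities of fast strings\<close>

lemma measure_fast: "measure coin_space {A. fast A x} = 1 / 2 ^ Suc (length x div 2)"
proof -
  let ?q = "\<lambda>j. str_to_nat (x @ replicate j False)"
  have "inj_on ?q {..length x div 2}" by (rule inj_onI) (auto simp: str_to_nat_inj)
  then have "card (?q ` {..length x div 2}) = Suc (length x div 2)" by (simp add: card_image)
  moreover have "{A. fast A x} = {A. \<forall>i \<in> ?q ` {..length x div 2}. A i = True}"
    by (auto simp: fast_def)
  ultimately show ?thesis using measure_fixed_bits(2)[of "?q ` {..length x div 2}" "\<lambda>_. True"] by simp
qed

text \<open>The set \<open>K\<close> of bits required to be 1 makes independence an elementary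
  induction: excluding one more block \<open>J x\<close> subtracts the same event with
  \<open>K\<close> enlarged by \<open>J x\<close>.\<close>

lemma measure_no_block:
  assumes "finite X" "finite K" "\<And>x. x \<in> X \<Longrightarrow> finite (J x) \<and> J x \<inter> K = {}" "disjoint_family_on J X"
  shows "{A. (\<forall>i\<in>K. A i) \<and> (\<forall>x\<in>X. \<not> (\<forall>i\<in>J x. A i))} \<in> sets coin_space \<and>
    measure coin_space {A. (\<forall>i\<in>K. A i) \<and> (\<forall>x\<in>X. \<not> (\<forall>i\<in>J x. A i))}
      = 1 / 2 ^ card K * (\<Prod>x\<in>X. 1 - 1 / 2 ^ card (J x))"
  using assms
proof (induction X arbitrary: K)
  case empty
  then show ?case using measure_fixed_bits[of K "\<lambda>_. True"] by simp
next
  case (insert x X)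
  let ?S = "\<lambda>K. {A. (\<forall>i\<in>K. A i) \<and> (\<forall>x\<in>X. \<not> (\<forall>i\<in>J x. A i))}"
  let ?p = "\<Prod>x\<in>X. 1 - 1 / 2 ^ card (J x) :: real"
  have dis: "disjoint_family_on J X" using insert.prems(3) by (auto simp: disjoint_family_on_def)
  have 1: "?S K \<in> sets coin_space" "measure coin_space (?S K) = 1 / 2 ^ card K * ?p"
    using insert.IH[of K] insert.prems dis by auto
  have "J y \<inter> (K \<union> J x) = {}" if "y \<in> X" for y
  proof -
    have "J y \<inter> J x = {}"
      using insert.hyps(2) that by (intro disjoint_family_onD[OF insert.prems(3)]) auto
    then show ?thesis using insert.prems(2)[of y] that by auto
  qed
  then have "?S (K \<union> J x) \<in> sets coin_space \<and> measure coin_space (?S (K \<union> J x)) = 1 / 2 ^ card (K \<union> J x) * ?p"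
    by (intro insert.IH) (use insert.prems dis in auto)
  moreover have "card (K \<union> J x) = card K + card (J x)"
    using insert.prems by (intro card_Un_disjoint) auto
  ultimately have 2: "?S (K \<union> J x) \<in> sets coin_space"
    "measure coin_space (?S (K \<union> J x)) = 1 / 2 ^ (card K + card (J x)) * ?p" by auto
  have eq: "{A. (\<forall>i\<in>K. A i) \<and> (\<forall>x\<in>insert x X. \<not> (\<forall>i\<in>J x. A i))} = ?S K - ?S (K \<union> J x)" by auto
  have "measure coin_space (?S K - ?S (K \<union> J x)) = 1 / 2 ^ card K * ?p - 1 / 2 ^ (card K + card (J x)) * ?p"
    by (subst coin.finite_measure_Diff) (use 1 2 in auto)
  also have "\<dots> = 1 / 2 ^ card K * (\<Prod>x\<in>insert x X. 1 - 1 / 2 ^ card (J x))"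
    using insert.hyps by (simp add: power_add algebra_simps)
  finally show ?case unfolding eq using 1 2 by auto
qed

lemma power_le_half:
  assumes "0 < (n::nat)"
  shows "(1 - 1 / real n) ^ n \<le> 1 / 2"
proof -
  have "1 - 1 / real n \<le> exp (- (1 / real n))"
    using exp_ge_add_one_self[of "- (1 / real n)"] by simp
  then have "(1 - 1 / real n) ^ n \<le> exp (- (1 / real n)) ^ n"
    using assms by (intro power_mono) auto
  also have "\<dots> = exp (real n * - (1 / real n))"
    by (rule exp_of_nat_mult[symmetric])
  also have "real n * - (1 / real n) = - 1" using assms by simp
  also have "exp (- 1 :: real) \<le> 1 / 2"
    using exp_ge_add_one_self[of "1 :: real"] by (simp add: exp_minus field_simps)
  finally show ?thesis .
qed

text \<open>With N = 2^(m+1), the probability is the power (1 - 1/N)^(4^m), and 4^m = N * 2^(m-1).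
  As (1 - 1/N)^N is at most 1/2, this gives the bound 2^-(2^(m-1)), and m is at most 2^(m-1) for
  positive m.\<close>

lemma measure_none_fast:
  "measure coin_space {A. \<forall>x. length x = 2 * m \<longrightarrow> \<not> fast A x} \<le> 1 / 2 ^ m"
proof (cases m)
  case 0
  then show ?thesis using coin.prob_le_1 by simp
next
  case (Suc k)
  let ?X = "{x :: bool list. length x = 2 * m}"
  define J where "J x = (\<lambda>j. str_to_nat (x @ replicate j False)) ` {..m}" for x
  have card: "card (J x) = Suc m" for x
    unfolding J_def by (subst card_image) (auto simp: inj_on_def str_to_nat_inj)
  have fin: "finite (J x)" for x by (simp add: J_def)
  have X: "finite ?X" "card ?X = 2 ^ (2 * m)"
    using finite_lists_length_eq[of "UNIV :: bool set" "2 * m"] card_lists_length_eq[of "UNIV :: bool set" "2 * m"]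
    by auto
  have "disjoint_family_on J ?X"
    unfolding disjoint_family_on_def J_def by (auto simp: str_to_nat_inj)
  then have "measure coin_space {A. (\<forall>i\<in>{}. A i) \<and> (\<forall>x\<in>?X. \<not> (\<forall>i\<in>J x. A i))}
      = 1 / 2 ^ card ({}::nat set) * (\<Prod>x\<in>?X. 1 - 1 / 2 ^ card (J x))"
    by (intro conjunct2[OF measure_no_block] X) (auto simp: fin)
  moreover have "{A. (\<forall>i\<in>{}. A i) \<and> (\<forall>x\<in>?X. \<not> (\<forall>i\<in>J x. A i))} = {A. \<forall>x. length x = 2 * m \<longrightarrow> \<not> fast A x}"
    by (auto simp: J_def fast_def)
  ultimately have "measure coin_space {A. \<forall>x. length x = 2 * m \<longrightarrow> \<not> fast A x} = (1 - 1 / 2 ^ Suc m) ^ (2 ^ (2 * m))"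
    by (simp add: card X)
  also have "(2::nat) ^ (2 * m) = 2 ^ Suc m * 2 ^ k"
    using Suc by (simp flip: power_add)
  also have "(1 - 1 / 2 ^ Suc m :: real) ^ (2 ^ Suc m * 2 ^ k) = ((1 - 1 / 2 ^ Suc m) ^ (2 ^ Suc m)) ^ 2 ^ k"
    by (rule power_mult)
  also have "\<dots> \<le> (1 / 2) ^ 2 ^ k"
  proof (rule power_mono)
    show "(1 - 1 / 2 ^ Suc m :: real) ^ (2 ^ Suc m) \<le> 1 / 2"
      using power_le_half[of "2 ^ Suc m"] by simp
    show "0 \<le> (1 - 1 / 2 ^ Suc m :: real) ^ (2 ^ Suc m)"
      using one_le_power[of "2 :: real" "Suc m"] by (intro zero_le_power) simp
  qed
  also have "(1 / 2 :: real) ^ 2 ^ k \<le> (1 / 2) ^ m"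
    using Suc by (intro power_decreasing) (simp_all add: Suc_leI)
  finally show ?thesis by (simp add: power_one_over)
qed

text \<open>Equals \<open>2 ^ m * (2 ^ (m + 6)) ^ m\<close>. The first factor absorbs a coefficient
  up to \<open>m\<close>, the second a power with exponent up to \<open>m\<close> of
  \<open>40 * m + 41\<close>, which is at most \<open>64 * (m + 1)\<close>. Here
  \<open>40 * m + 40\<close> is the time for rejecting fast strings of length
  \<open>2 * m\<close>.\<close>

definition bound :: "nat \<Rightarrow> nat" where "bound m = 2 ^ (m * (m + 7))"

definition accepts :: "nat \<Rightarrow> nat \<Rightarrow> nat \<Rightarrow> bool" where
  "accepts e v t \<longleftrightarrow> sim_state e v t = get e (pair 0 2)"

definition rejects :: "nat \<Rightarrow> nat \<Rightarrow> nat \<Rightarrow> bool" where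
  "rejects e v t \<longleftrightarrow> sim_state e v t = get e (pair 0 3)"

text \<open>At length \<open>2 * m\<close> the language disagrees with machine \<open>pfst m\<close> on the first string on which
this machine halts within \<open>bound m\<close> steps.\<close>

definition diagonal :: "nat \<Rightarrow> nat \<Rightarrow> bool" where
  "diagonal m v \<longleftrightarrow> clength v = 2 * m \<and> rejects (pfst m) v (bound m) \<and>
     (\<forall>u<v. \<not> (clength u = 2 * m \<and> (accepts (pfst m) u (bound m) \<or> rejects (pfst m) u (bound m))))"

lemma prp_diagonal:
  assumes f: "pr f" and h: "pr h"
  shows "prp (\<lambda>x. diagonal (f x) (h x))"
  unfolding diagonal_def accepts_def rejects_def bound_def
  by (intro f h pr_rules pr_clength pr_sim_state pr_get pr_comp[OF f] pr_comp[OF h])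

lemma diagonal_unique: "diagonal m v \<Longrightarrow> diagonal m w \<Longrightarrow> v = w"
  unfolding diagonal_def by (meson linorder_neqE_nat)

definition E1 :: "nat \<Rightarrow> (nat \<Rightarrow> bool) set" where
  "E1 m = {A. \<exists>x. diagonal m (bcode x) \<and> fast A x}"

definition E2 :: "nat \<Rightarrow> (nat \<Rightarrow> bool) set" where
  "E2 m = {A. \<forall>x. length x = 2 * m \<longrightarrow> \<not> fast A x}"

text \<open>The candidate is unique and chosen without \<open>A\<close>, so the event is empty or
  says that one fixed string is fast.\<close>

interpretation E1: local_events E1 "\<lambda>m. 2 ^ (3 * m + 1)"
  "\<lambda>m s. \<exists>v < 2 ^ (2 * m + 1). diagonal m v \<and> cfast s v"
proof
  show "pr (\<lambda>m. 2 ^ (3 * m + 1))" by (intro pr_rules)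
  show "prp (\<lambda>z. \<exists>v < 2 ^ (2 * pfst z + 1). diagonal (pfst z) v \<and> cfast (psnd z) v)"
    by (intro pr_rules prp_diagonal prp_cfast)
  show "A \<in> E1 m \<longleftrightarrow> (\<exists>v < 2 ^ (2 * m + 1). diagonal m v \<and> cfast (bcode (map A [0..<n])) v)"
    if "2 ^ (3 * m + 1) \<le> n" for m n A
  proof
    assume "A \<in> E1 m"
    then obtain x where x: "diagonal m (bcode x)" "fast A x" by (auto simp: E1_def)
    then have l: "length x = 2 * m" by (simp add: diagonal_def clength_bcode)
    then have "bcode x < 2 ^ (2 * m + 1)" using bcode_le[of x] by simp
    with x cfast_prefix[OF l that] show "\<exists>v < 2 ^ (2 * m + 1). diagonal m v \<and> cfast (bcode (map A [0..<n])) v"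
      by blast
  next
    assume "\<exists>v < 2 ^ (2 * m + 1). diagonal m v \<and> cfast (bcode (map A [0..<n])) v"
    then obtain x where x: "diagonal m (bcode x)" "cfast (bcode (map A [0..<n])) (bcode x)"
      by (metis bcode_surj)
    then have l: "length x = 2 * m" by (simp add: diagonal_def clength_bcode)
    with x cfast_prefix[OF l that] show "A \<in> E1 m" by (auto simp: E1_def)
  qed
  show "measure coin_space (E1 m) \<le> 1 / 2 ^ m" for m
  proof (cases "\<exists>x. diagonal m (bcode x)")
    case True
    then obtain x where x: "diagonal m (bcode x)" by blast
    then have l: "length x = 2 * m" by (simp add: diagonal_def clength_bcode)
    have "y = x" if "diagonal m (bcode y)" for y
      using diagonal_unique[OF that x] by (simp add: bcode_inj)
    with x have "E1 m = {A. fast A x}" unfolding E1_def by blast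
    then show ?thesis by (simp add: measure_fast l field_simps)
  next
    case False
    then have "E1 m = {}" by (auto simp: E1_def)
    then show ?thesis by simp
  qed
qed

interpretation E2: local_events E2 "\<lambda>m. 2 ^ (3 * m + 1)"
  "\<lambda>m s. \<forall>v < 2 ^ (2 * m + 1). \<not> (clength v = 2 * m \<and> cfast s v)"
proof
  show "pr (\<lambda>m. 2 ^ (3 * m + 1))" by (intro pr_rules)
  show "prp (\<lambda>z. \<forall>v < 2 ^ (2 * pfst z + 1). \<not> (clength v = 2 * pfst z \<and> cfast (psnd z) v))"
    by (intro pr_rules pr_clength prp_cfast)
  show "A \<in> E2 m \<longleftrightarrow> (\<forall>v < 2 ^ (2 * m + 1). \<not> (clength v = 2 * m \<and> cfast (bcode (map A [0..<n])) v))"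
    if n: "2 ^ (3 * m + 1) \<le> n" for m n A
  proof
    assume A: "A \<in> E2 m"
    show "\<forall>v < 2 ^ (2 * m + 1). \<not> (clength v = 2 * m \<and> cfast (bcode (map A [0..<n])) v)"
    proof (intro allI impI notI)
      fix v assume v: "clength v = 2 * m \<and> cfast (bcode (map A [0..<n])) v"
      obtain x where x: "v = bcode x" using bcode_surj by metis
      with v have l: "length x = 2 * m" by (simp add: clength_bcode)
      with v x cfast_prefix[OF l n] A show False by (auto simp: E2_def)
    qed
  next
    assume *: "\<forall>v < 2 ^ (2 * m + 1). \<not> (clength v = 2 * m \<and> cfast (bcode (map A [0..<n])) v)"
    have "\<not> fast A x" if l: "length x = 2 * m" for x
    proof -
      have "bcode x < 2 ^ (2 * m + 1)" using bcode_le[of x] l by simp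
      with * l have "\<not> cfast (bcode (map A [0..<n])) (bcode x)" by (simp add: clength_bcode)
      then show ?thesis using cfast_prefix[OF l n] by simp
    qed
    then show "A \<in> E2 m" by (simp add: E2_def)
  qed
  show "measure coin_space (E2 m) \<le> 1 / 2 ^ m" for m
    unfolding E2_def by (rule measure_none_fast)
qed

section \<open>Diagonal argument for a low for speed oracle\<close>

lemma run_halted:
  assumes "fst (run M A x t) \<in> {q_accept M, q_reject M}" "t \<le> u"
  shows "run M A x u = run M A x t"
proof -
  have "run M A x (t + d) = run M A x t" for d
  proof (induction d)
    case (Suc d)
    have "run M A x (t + Suc d) = step M A (run M A x (t + d))" by (simp add: run_def)
    also have "\<dots> = run M A x t"
      using assms(1) unfolding Suc by (cases "run M A x t") (auto simp: step_def)
    finally show ?case .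
  qed simp
  from this[of "u - t"] show ?thesis using assms(2) by simp
qed

lemma poly_nat_le: "\<exists>B d. \<forall>n. poly (p :: nat poly) n \<le> B * (n + 1) ^ d"
proof (induction p)
  case 0
  show ?case by simp
next
  case (pCons a p)
  then obtain B d where B: "\<And>n. poly p n \<le> B * (n + 1) ^ d" by blast
  have "poly (pCons a p) n \<le> (a + B) * (n + 1) ^ Suc d" for n
  proof -
    have "n * poly p n \<le> (n + 1) * (B * (n + 1) ^ d)" using B[of n] by (intro mult_mono) auto
    moreover have "a * 1 \<le> a * (n + 1) ^ Suc d" by (intro mult_left_mono one_le_power) auto
    ultimately show ?thesis by (simp add: algebra_simps)
  qed
  then show ?case by blast
qed

lemma poly_le_bound:
  assumes "\<And>n. poly (p :: nat poly) n \<le> B * (n + 1) ^ d" "B \<le> m" "d \<le> m"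
  shows "poly p (40 * m + 40) \<le> bound m"
proof -
  have m: "m < 2 ^ m" by (rule less_exp)
  have "poly p (40 * m + 40) \<le> B * (40 * m + 40 + 1) ^ d" by (rule assms(1))
  also have "\<dots> \<le> 2 ^ m * (2 ^ (m + 6)) ^ m"
  proof (rule mult_mono)
    have "(40 * m + 40 + 1) ^ d \<le> (40 * m + 40 + 1) ^ m" using assms(3) by (intro power_increasing) auto
    also have "\<dots> \<le> (2 ^ (m + 6)) ^ m"
    proof (rule power_mono)
      have "40 * m + 40 + 1 \<le> 64 * Suc m" by simp
      also have "\<dots> \<le> 64 * 2 ^ m" using Suc_leI[OF m] by simp
      finally show "40 * m + 40 + 1 \<le> 2 ^ (m + 6)" by (simp add: power_add)
    qed simp
    finally show "(40 * m + 40 + 1) ^ d \<le> (2 ^ (m + 6)) ^ m" .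
    show "B \<le> 2 ^ m" using assms(2) m by (rule less_imp_le[OF le_less_trans])
  qed auto
  also have "\<dots> = bound m"
    unfolding bound_def power_mult[symmetric] power_add[symmetric]
    by (rule arg_cong[where f = "\<lambda>i. 2 ^ i"]) (simp add: algebra_simps)
  finally show ?thesis .
qed

lemma low_for_speed_limsup:
  assumes "low_for_speed A"
  shows "A \<in> (\<Inter>n. E1.U n) \<union> (\<Inter>n. E2.U n)"
proof (rule ccontr)
  assume "A \<notin> (\<Inter>n. E1.U n) \<union> (\<Inter>n. E2.U n)"
  then obtain n1 n2 where "A \<notin> E1.U n1" "A \<notin> E2.U n2" by blast
  then have A: "\<And>m. n1 + n2 < m \<Longrightarrow> A \<notin> E1 m" "\<And>m. n1 + n2 < m \<Longrightarrow> A \<notin> E2 m"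
    unfolding E1.U_def E2.U_def by auto
  \<comment> \<open>Lengths up to \<open>2 * N\<close> are left out of \<open>L\<close>, so the
    exceptional events there do no harm and no fast string lies in \<open>L\<close>. The oracle
    enters \<open>L\<close> only through this number, so \<open>L\<close> stays computable.\<close>
  define N where "N = n1 + n2"
  define \<phi> where "\<phi> v \<longleftrightarrow> N < clength v div 2 \<and> diagonal (clength v div 2) v" for v
  define L where "L = {x. \<phi> (bcode x)}"
  have "prp \<phi>" unfolding \<phi>_def by (intro pr_rules pr_clength prp_diagonal)
  then have "computable_lang L" unfolding L_def by (rule computable_lang_prp)
  from prp_decider[OF \<open>prp \<phi>\<close>] obtain M where "wf_tm M"
    and M_fast: "\<And>A x. fast A x \<Longrightarrow> \<exists>t \<le> 20 * length x + 40. fst (run M A x t) = q_reject M"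
    and M_slow: "\<And>A x. \<not> fast A x \<Longrightarrow> \<exists>t. fst (run M A x t) = (if \<phi> (bcode x) then q_accept M else q_reject M)"
    by blast
  have ne: "q_accept M \<noteq> q_reject M" using \<open>wf_tm M\<close> by (auto simp: wf_tm_def)
  have fast_L: "x \<notin> L" if "fast A x" for x
  proof
    assume "x \<in> L"
    then have "A \<in> E1 (length x div 2)" "N < length x div 2"
      using that by (auto simp: L_def \<phi>_def E1_def clength_bcode)
    then show False using A(1) by (simp add: N_def)
  qed
  \<comment> \<open>\<open>decides_within\<close> accepts any function as bound, so on strings that
    are not fast some halting time is simply chosen.\<close>
  define time where "time x = (SOME t. fst (run M A x t) = (if \<phi> (bcode x) then q_accept M else q_reject M))" for x
  define f where "f x = (if fast A x then 20 * length x + 40 else time x)" for x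
  have "\<exists>t \<le> f x. fst (run M A x t) \<in> {q_accept M, q_reject M} \<and> (fst (run M A x t) = q_accept M \<longleftrightarrow> x \<in> L)" for x
  proof (cases "fast A x")
    case True
    with M_fast[of A x] fast_L[of x] ne show ?thesis by (fastforce simp: f_def)
  next
    case False
    then have "fst (run M A x (time x)) = (if \<phi> (bcode x) then q_accept M else q_reject M)"
      unfolding time_def by (intro someI_ex[OF M_slow])
    with False ne show ?thesis by (intro exI[of _ "time x"]) (simp add: f_def L_def)
  qed
  with \<open>wf_tm M\<close> have "decides_within M A L f" unfolding decides_within_def by blast
  with assms \<open>computable_lang L\<close> obtain M' and p :: "nat poly"
    where "decides_within M' no_oracle L (\<lambda>x. poly p (f x))"
    unfolding low_for_speed_def by blast
  then have wf: "wf_tm M'" and M': "\<And>x. \<exists>t \<le> poly p (f x). fst (run M' no_oracle x t) \<in> {q_accept M', q_reject M'} \<and>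
      (fst (run M' no_oracle x t) = q_accept M' \<longleftrightarrow> x \<in> L)"
    unfolding decides_within_def by blast+
  obtain e where e: "codes_tm e M'" using ex_codes_tm by blast
  obtain B d where B: "\<And>n. poly p n \<le> B * (n + 1) ^ d" using poly_nat_le by blast
  \<comment> \<open>The second component pads the code: it makes \<open>m\<close> exceed
    \<open>B\<close>, \<open>d\<close> and \<open>N\<close>, while \<open>pfst m\<close> remains
    \<open>e\<close>.\<close>
  define m where "m = pair e (B + d + N + 1)"
  have m: "B + d + N + 1 \<le> m" unfolding m_def by (rule le_prod_encode_2)
  have em: "pfst m = e" by (simp add: m_def)
  have acc: "accepts e (bcode x) t \<longleftrightarrow> fst (run M' no_oracle x t) = q_accept M'"
    and rej: "rejects e (bcode x) t \<longleftrightarrow> fst (run M' no_oracle x t) = q_reject M'" for x t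
    using e unfolding accepts_def rejects_def sim_state_run[OF wf e] codes_tm_def by auto
  define H where "H v \<longleftrightarrow> clength v = 2 * m \<and> (accepts e v (bound m) \<or> rejects e v (bound m))" for v
  have "\<exists>v. H v"
  proof -
    \<comment> \<open>A halting time within \<open>bound m\<close> can be guaranteed only on a fast
      string, where \<open>f x = 40 * m + 40\<close>.\<close>
    have "A \<notin> E2 m" using A(2) m by (simp add: N_def)
    then obtain x where x: "length x = 2 * m" "fast A x" by (auto simp: E2_def)
    obtain t where t: "t \<le> poly p (f x)" "fst (run M' no_oracle x t) \<in> {q_accept M', q_reject M'}"
      using M' by blast
    have "poly p (f x) \<le> bound m"
      using poly_le_bound[OF B, of m] m x by (simp add: f_def)
    then have "run M' no_oracle x (bound m) = run M' no_oracle x t"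
      using t(1) by (intro run_halted[OF t(2)]) linarith
    with t(2) x(1) have "H (bcode x)" by (auto simp: H_def acc rej clength_bcode)
    then show ?thesis by blast
  qed
  then have v: "H (LEAST v. H v)" by (rule LeastI_ex)
  \<comment> \<open>\<open>y\<close> may differ from the fast string just found and need not be
    fast; what matters is that \<open>M'\<close> halts on it within \<open>bound m\<close>.\<close>
  obtain y where y: "bcode y = (LEAST v. H v)" using bcode_surj by blast
  have least: "\<not> H u" if "u < bcode y" for u using not_less_Least that y by metis
  from v have Hy: "H (bcode y)" by (simp add: y)
  then have len: "length y = 2 * m" by (simp add: H_def clength_bcode)
  have L: "y \<in> L \<longleftrightarrow> rejects e (bcode y) (bound m)"
    using least m len unfolding L_def \<phi>_def diagonal_def mem_Collect_eq clength_bcode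
    by (auto simp: em H_def)
  have halt: "fst (run M' no_oracle y (bound m)) \<in> {q_accept M', q_reject M'}"
    using Hy by (auto simp: H_def acc rej)
  obtain t where t: "fst (run M' no_oracle y t) \<in> {q_accept M', q_reject M'}"
      "fst (run M' no_oracle y t) = q_accept M' \<longleftrightarrow> y \<in> L" using M' by blast
  \<comment> \<open>From the earlier of the two halting times on the configuration is frozen, so
    both verdicts agree.\<close>
  have "run M' no_oracle y (bound m) = run M' no_oracle y t"
    using run_halted[OF halt, of t] run_halted[OF t(1), of "bound m"] by (cases "bound m \<le> t") auto
  moreover have "q_accept M' \<noteq> q_reject M'" using wf by (auto simp: wf_tm_def)
  ultimately show False using halt t(2) L by (auto simp: rej)
qed

theorem theorem4p1:
  shows "(\<forall>A. schnorr_random A \<longrightarrow> \<not> low_for_speed A) \<and>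
         (\<exists>N \<in> null_sets coin_space. LFS \<subseteq> N)"
proof (intro conjI allI impI notI)
  fix A assume "schnorr_random A" "low_for_speed A"
  then show False
    using low_for_speed_limsup E1.schnorr_random_avoids E2.schnorr_random_avoids by blast
next
  have "(\<Inter>n. E1.U n) \<union> (\<Inter>n. E2.U n) \<in> null_sets coin_space"
    by (intro null_sets.Un E1.null_limsup E2.null_limsup)
  moreover have "LFS \<subseteq> (\<Inter>n. E1.U n) \<union> (\<Inter>n. E2.U n)"
    unfolding LFS_def using low_for_speed_limsup by blast
  ultimately show "\<exists>N \<in> null_sets coin_space. LFS \<subseteq> N" by blast
qed

end
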